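(* Let $U,V\in L^\infty(\mathbb{R})$ be real-valued functions of compact support and let $\{\alpha_\lambda\}_{\lambda>0}$ be positive numbers with $\alpha_\lambda\to+\infty$ as $\lambda\to0$. Let $H_\lambda=-\frac{d^2}{dx^2}+U(x)+\lambda\alpha_\lambda V(\alpha_\lambda x)$ on $W_2^2(\mathbb{R})$ and $H_0=-\frac{d^2}{dx^2}+U$. Suppose $H_0$ has a zero-energy resonance with normalized half-bound state $u$, and let $\theta=\lim_{x\to+\infty}u(x)$. If $$\int_{\mathbb{R}}V\,dx=0,\qquad u(0)u'(0)\int_{\mathbb{R}}xV(x)\,dx<0,$$ and $\alpha_\lambda=o(\lambda^{-1/3})$ as $\lambda\to0$, then $H_\lambda$ has the coupling constant threshold $\lambda=0$, and the threshold eigenvalue satisfies $$e_\lambda=-\frac{\lambda^2}{\alpha_\lambda^2}\left(\Big(\frac{2u(0)u'(0)}{\theta^2+1}\int_{\mathbb{R}}xV(x)\,dx\Big)^2+o(1)\right)\quad\text{as }\lambda\to0.$$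
   Context: $H_0$ possesses a zero-energy resonance if there is a nontrivial solution $h$ of $-h''+Uh=0$ bounded on $\mathbb{R}$ (a half-bound state); its limits $h_\pm=\lim_{x\to\pm\infty}h(x)$ exist and are nonzero, and the normalized half-bound state is $u=h/h_-$ (so $u\to1$ as $x\to-\infty$). The coupling constant threshold $\lambda=0$ means: for all small $\lambda>0$, $H_\lambda$ has a negative eigenvalue $e_\lambda$ with $e_\lambda\to0$ as $\lambda\to0$. *)

theory Defs
  imports "HOL-Analysis.Analysis" "HOL-Library.Landau_Symbols"
begin

text \<open>f is C^1 with derivative f', and f' is locally absolutely continuous
  with a.e. derivative g (g locally integrable).\<close>
definition second_deriv :: "(real \<Rightarrow> real) \<Rightarrow> (real \<Rightarrow> real) \<Rightarrow> (real \<Rightarrow> real) \<Rightarrow> bool" where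
  "second_deriv f f' g \<longleftrightarrow>
     (\<forall>x. (f has_real_derivative f' x) (at x)) \<and>
     (\<forall>a b. set_integrable lborel {a..b} g) \<and>
     (\<forall>x. f' x = f' 0 + (LBINT t=0..x. g t))"

definition square_integrable :: "(real \<Rightarrow> real) \<Rightarrow> bool" where
  "square_integrable f \<longleftrightarrow> f \<in> borel_measurable lborel \<and> integrable lborel (\<lambda>x. (f x)\<^sup>2)"

definition in_W22 :: "(real \<Rightarrow> real) \<Rightarrow> (real \<Rightarrow> real) \<Rightarrow> (real \<Rightarrow> real) \<Rightarrow> bool" where
  "in_W22 f f' g \<longleftrightarrow> second_deriv f f' g \<and> square_integrable f \<and> square_integrable f' \<and> square_integrable g"

definition schr_eigenvalue :: "(real \<Rightarrow> real) \<Rightarrow> real \<Rightarrow> bool" where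
  "schr_eigenvalue W e \<longleftrightarrow> (\<exists>f f' g. in_W22 f f' g \<and> \<not> (AE x in lborel. f x = 0) \<and>
      (AE x in lborel. - g x + W x * f x = e * f x))"

definition half_bound_state :: "(real \<Rightarrow> real) \<Rightarrow> (real \<Rightarrow> real) \<Rightarrow> bool" where
  "half_bound_state U h \<longleftrightarrow> (\<exists>h' g. second_deriv h h' g \<and>
      (AE x in lborel. - g x + U x * h x = 0)) \<and> bounded (range h) \<and> (\<exists>x. h x \<noteq> 0)"

definition Linf_compact :: "(real \<Rightarrow> real) \<Rightarrow> bool" where
  "Linf_compact U \<longleftrightarrow> U \<in> borel_measurable lborel \<and> (\<exists>M. AE x in lborel. \<bar>U x\<bar> \<le> M) \<and>
      (\<exists>R. AE x in lborel. R < \<bar>x\<bar> \<longrightarrow> U x = 0)"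

end

theory Submission
  imports Defs
begin

text \<open>
  For \<open>k \<ge> 0\<close> let \<open>f\<close> solve \<open>f'' = (U + W + k\<^sup>2) f\<close>, where \<open>W x = l a V(a x)\<close>, with \<open>f = e\<^bsup>k (x + R)\<^esup>\<close> to the
  left of the supports. Then \<open>-k\<^sup>2\<close> is an eigenvalue if \<open>F(k) = f'(R) + k f(R)\<close> vanishes. The Wronskian of \<open>f\<close> with
  the half-bound state \<open>u\<close>, which is \<open>1\<close> on the left and \<open>\<theta>\<close> on the right, gives
  \<open>\<theta> F(k) = k + k \<theta> f(R) + \<integral> (W + k\<^sup>2) u f\<close>. As \<open>l a \<rightarrow> 0\<close>, \<open>f\<close> is \<open>C\<^sup>1\<close>-close to \<open>u\<close>, and since \<open>V\<close> has mean zero, the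
  integral of \<open>W u f\<close> is \<open>(l / a) (2 u(0) u'(0) \<integral> x V + o(1))\<close>. On the scale \<open>k = s l / a\<close> the function \<open>(a / l) \<theta> F\<close>
  therefore converges, uniformly for bounded \<open>s\<close>, to \<open>s (1 + \<theta>\<^sup>2) + 2 u(0) u'(0) \<integral> x V\<close>, and the intermediate
  value theorem yields a zero near the positive root of this affine function.
\<close>

section \<open>Picard iteration, Gronwall's inequality and integration by parts\<close>

lemma continuous_on_Icc_bounded:
  fixes f :: "real \<Rightarrow> real"
  assumes "continuous_on {a..b} f"
  shows "\<exists>C. \<forall>x\<in>{a..b}. \<bar>f x\<bar> \<le> C"
  using compact_imp_bounded[OF compact_continuous_image[OF assms]] by (auto simp: bounded_iff)

lemma set_integrable_bounded_times_continuous: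
  fixes q f :: "real \<Rightarrow> real"
  assumes q: "q \<in> borel_measurable borel" "\<And>x. \<bar>q x\<bar> \<le> M" and f: "continuous_on {a..b} f"
  shows "set_integrable lborel {a..b} (\<lambda>t. q t * f t)"
proof -
  have i: "integrable lborel (\<lambda>t. indicator {a..b} t *\<^sub>R f t)"
    using borel_integrable_atLeastAtMost'[OF f] by (simp add: set_integrable_def)
  have "integrable lborel (\<lambda>t. M * (indicator {a..b} t *\<^sub>R f t))"
    using i by (rule integrable_mult_right)
  moreover have "(\<lambda>t. q t * (indicator {a..b} t *\<^sub>R f t)) \<in> borel_measurable lborel"
    using q(1) borel_measurable_integrable[OF i] by measurable
  ultimately have "integrable lborel (\<lambda>t. q t * (indicator {a..b} t *\<^sub>R f t))"
    by (rule Bochner_Integration.integrable_bound)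
      (intro AE_I2, use q(2) abs_ge_self[of M] order_trans in \<open>fastforce simp: abs_mult intro!: mult_right_mono\<close>)
  then show ?thesis by (simp add: set_integrable_def mult.left_commute)
qed

lemma integrable_on_bounded_times_continuous:
  fixes q f :: "real \<Rightarrow> real"
  assumes "q \<in> borel_measurable borel" "\<And>x. \<bar>q x\<bar> \<le> M" "continuous_on {a..b} f"
  shows "(\<lambda>t. q t * f t) integrable_on {a..b}"
  using set_borel_integral_eq_integral(1)[OF set_integrable_bounded_times_continuous[OF assms]] .

text \<open>The successive approximations converge on the whole interval at once, with no smallness
  of \<open>b - a\<close>, because their increments are measured against the weight
  \<open>exp (2 * L * (x - a))\<close>. Integrability along continuous curves takes the place of
  continuity of \<open>G\<close> in \<open>t\<close>, as a merely measurable potential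
  requires.\<close>

lemma picard_existence:
  fixes G :: "real \<Rightarrow> 'a::banach \<Rightarrow> 'a"
  assumes lip: "\<And>t y z. norm (G t y - G t z) \<le> L * norm (y - z)" and L: "L > 0"
    and int: "\<And>y. continuous_on {a..b} y \<Longrightarrow> (\<lambda>t. G t (y t)) integrable_on {a..b}"
  obtains y where "continuous_on {a..b} y"
    "\<And>x. x \<in> {a..b} \<Longrightarrow> y x = y0 + integral {a..x} (\<lambda>t. G t (y t))"
proof -
  define Y where "Y = rec_nat (\<lambda>x. y0) (\<lambda>n Yn x. y0 + integral {a..x} (\<lambda>t. G t (Yn t)))"
  have Y0: "Y 0 = (\<lambda>x. y0)" and YS: "Y (Suc n) = (\<lambda>x. y0 + integral {a..x} (\<lambda>t. G t (Y n t)))" for n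
    by (auto simp: Y_def)
  have cY: "continuous_on {a..b} (Y n)" for n
    by (induction n) (auto simp: Y0 YS intro!: continuous_intros indefinite_integral_continuous_1 int)
  have intx: "(\<lambda>t. G t (y t)) integrable_on {a..x}" if "continuous_on {a..b} y" "x \<in> {a..b}" for y x
    using int[OF that(1)] by (rule integrable_on_subinterval) (use that in auto)
  obtain C where C: "\<And>x. x \<in> {a..b} \<Longrightarrow> norm (Y 1 x - Y 0 x) \<le> C"
  proof -
    have "bounded ((\<lambda>x. Y 1 x - Y 0 x) ` {a..b})"
      by (intro compact_imp_bounded compact_continuous_image continuous_intros cY) auto
    then show ?thesis using that unfolding bounded_iff by blast
  qed
  \<comment> \<open>Integrating the weight gains a factor \<open>1 / (2 * L)\<close>, which turns
    the Lipschitz constant \<open>L\<close> into the contraction factor \<open>1/2\<close>.\<close>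
  have inc: "norm (Y (Suc n) x - Y n x) \<le> C * (1/2)^n * exp (2 * L * (x - a))" if "x \<in> {a..b}" for n x
    using that
  proof (induction n arbitrary: x)
    case 0
    have "0 \<le> C" using C[OF 0] norm_ge_zero order_trans by blast
    then have "C * 1 \<le> C * exp (2 * L * (x - a))" using 0 L by (intro mult_left_mono) auto
    then show ?case using C[OF 0] by simp
  next
    case (Suc n)
    let ?K = "C * (1/2)^n * L"
    have hi: "((\<lambda>t. ?K * exp (2 * L * (t - a))) has_integral
        (?K * exp (2 * L * (x - a)) / (2 * L) - ?K * exp (2 * L * (a - a)) / (2 * L))) {a..x}"
      using Suc.prems L
      by (intro fundamental_theorem_of_calculus)
        (auto intro!: derivative_eq_intros simp: has_real_derivative_iff_has_vector_derivative[symmetric])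
    have C0: "0 \<le> C" using C[OF Suc.prems] norm_ge_zero order_trans by blast
    have "Y (Suc (Suc n)) x - Y (Suc n) x
        = integral {a..x} (\<lambda>t. G t (Y (Suc n) t) - G t (Y n t))"
    proof -
      have "Y (Suc (Suc n)) x = y0 + integral {a..x} (\<lambda>t. G t (Y (Suc n) t))"
        "Y (Suc n) x = y0 + integral {a..x} (\<lambda>t. G t (Y n t))" by (simp_all only: YS)
      with Henstock_Kurzweil_Integration.integral_diff[OF intx[OF cY Suc.prems, of "Suc n"] intx[OF cY Suc.prems, of n]]
      show ?thesis by simp
    qed
    also have "norm \<dots> \<le> integral {a..x} (\<lambda>t. ?K * exp (2 * L * (t - a)))"
    proof (rule Henstock_Kurzweil_Integration.integral_norm_bound_integral)
      show "(\<lambda>t. G t (Y (Suc n) t) - G t (Y n t)) integrable_on {a..x}"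
        by (intro integrable_diff intx cY Suc.prems)
      show "(\<lambda>t. ?K * exp (2 * L * (t - a))) integrable_on {a..x}" using hi by blast
      fix t assume t: "t \<in> {a..x}"
      have "norm (G t (Y (Suc n) t) - G t (Y n t)) \<le> L * norm (Y (Suc n) t - Y n t)" by (rule lip)
      also have "\<dots> \<le> L * (C * (1/2)^n * exp (2 * L * (t - a)))"
        using L t Suc.prems by (intro mult_left_mono Suc.IH) auto
      finally show "norm (G t (Y (Suc n) t) - G t (Y n t)) \<le> ?K * exp (2 * L * (t - a))"
        by (simp add: mult_ac)
    qed
    also have "\<dots> \<le> ?K * exp (2 * L * (x - a)) / (2 * L)"
      using integral_unique[OF hi] C0 L by simp
    also have "\<dots> = C * (1/2)^Suc n * exp (2 * L * (x - a))" using L by (simp add: field_simps)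
    finally show ?case .
  qed
  have "uniformly_convergent_on {a..b} (\<lambda>n x. \<Sum>i<n. Y (Suc i) x - Y i x)"
  proof (rule Weierstrass_m_test')
    show "norm (Y (Suc n) x - Y n x) \<le> \<bar>C\<bar> * exp (2 * L * (b - a)) * (1/2)^n" if "x \<in> {a..b}" for n x
    proof -
      have "C * (1/2)^n * exp (2 * L * (x - a)) \<le> \<bar>C\<bar> * (1/2)^n * exp (2 * L * (b - a))"
        using that L by (intro mult_mono) auto
      from order_trans[OF inc[OF that] this] show ?thesis by (simp only: mult_ac)
    qed
    show "summable (\<lambda>n. \<bar>C\<bar> * exp (2 * L * (b - a)) * (1/2)^n)"
      by (intro summable_mult summable_geometric) auto
  qed
  then obtain z where z: "uniform_limit {a..b} (\<lambda>n x. \<Sum>i<n. Y (Suc i) x - Y i x) z sequentially"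
    by (auto simp: uniformly_convergent_on_def)
  define y where "y x = y0 + z x" for x
  have "uniform_limit {a..b} (\<lambda>n x. y0 + (\<Sum>i<n. Y (Suc i) x - Y i x)) y sequentially"
    unfolding y_def by (intro uniform_limit_add z uniform_limit_const)
  moreover have "y0 + (\<Sum>i<n. Y (Suc i) x - Y i x) = Y n x" for n x
    by (subst sum_lessThan_telescope) (simp add: Y0)
  ultimately have lim: "uniform_limit {a..b} Y y sequentially" by simp
  have cy: "continuous_on {a..b} y"
    by (rule uniform_limit_theorem[OF _ lim]) (auto simp: cY)
  have "y x = y0 + integral {a..x} (\<lambda>t. G t (y t))" if x: "x \<in> {a..b}" for x
  proof -
    have "(\<lambda>n. integral {a..x} (\<lambda>t. G t (Y n t))) \<longlonglongrightarrow> integral {a..x} (\<lambda>t. G t (y t))"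
    proof (rule LIMSEQ_I)
      fix e :: real assume e: "e > 0"
      \<comment> \<open>The summand 1 keeps the denominator positive at \<open>x = a\<close>; the
        factor 2 leaves \<open>e / 2\<close>, so that the final inequality is strict.\<close>
      define d where "d = e / (2 * L * (x - a + 1))"
      have d: "d > 0" using e L x by (auto simp: d_def)
      from uniform_limitD[OF lim d] obtain N where
        N: "\<And>n t. n \<ge> N \<Longrightarrow> t \<in> {a..b} \<Longrightarrow> norm (Y n t - y t) < d"
        unfolding eventually_sequentially dist_norm by blast
      have "norm (integral {a..x} (\<lambda>t. G t (Y n t)) - integral {a..x} (\<lambda>t. G t (y t))) < e" if n: "n \<ge> N" for n
      proof -
        have "integral {a..x} (\<lambda>t. G t (Y n t)) - integral {a..x} (\<lambda>t. G t (y t))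
          = integral {a..x} (\<lambda>t. G t (Y n t) - G t (y t))"
          by (rule Henstock_Kurzweil_Integration.integral_diff[symmetric]) (intro intx cY cy x)+
        also have "norm \<dots> \<le> integral {a..x} (\<lambda>t. L * d)"
        proof (rule Henstock_Kurzweil_Integration.integral_norm_bound_integral)
          show "(\<lambda>t. G t (Y n t) - G t (y t)) integrable_on {a..x}"
            by (intro integrable_diff intx cY cy x)
          fix t assume "t \<in> {a..x}"
          then have "L * norm (Y n t - y t) \<le> L * d" using N[OF n, of t] x L by (intro mult_left_mono) auto
          then show "norm (G t (Y n t) - G t (y t)) \<le> L * d" using lip order_trans by blast
        qed auto
        also have "\<dots> = (x - a) * (L * d)" using x by simp
        also have "\<dots> \<le> (x - a + 1) * (L * d)" using d L by (intro mult_right_mono) auto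
        also have "\<dots> = e / 2"
        proof -
          have "m * (L * (e / (2 * L * m))) = e / 2" if "m > 0" for m using that L by simp
          from this[of "x - a + 1"] show ?thesis using x unfolding d_def by auto
        qed
        also have "\<dots> < e" using e by simp
        finally show ?thesis .
      qed
      then show "\<exists>N. \<forall>n\<ge>N. norm (integral {a..x} (\<lambda>t. G t (Y n t)) - integral {a..x} (\<lambda>t. G t (y t))) < e" by blast
    qed
    then have "(\<lambda>n. Y (Suc n) x) \<longlonglongrightarrow> y0 + integral {a..x} (\<lambda>t. G t (y t))"
      unfolding YS by (intro tendsto_intros)
    moreover have "(\<lambda>n. Y (Suc n) x) \<longlonglongrightarrow> y x"
      using tendsto_uniform_limitI[OF lim x] LIMSEQ_Suc by blast
    ultimately show ?thesis using LIMSEQ_unique by blast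
  qed
  with cy that show ?thesis by blast
qed

text \<open>Multiplying \<open>c + L * integral {a..x} w\<close> by the integrating factor
  \<open>exp (- L * (x - a))\<close> gives a function with nonpositive derivative, by
  \<open>le\<close>. Continuity of \<open>w\<close> makes the integral differentiable.\<close>

lemma gronwall:
  fixes w :: "real \<Rightarrow> real"
  assumes w: "continuous_on {a..b} w" and L: "L \<ge> 0"
    and le: "\<And>x. x \<in> {a..b} \<Longrightarrow> w x \<le> c + L * integral {a..x} w" and x: "x \<in> {a..b}"
  shows "w x \<le> c * exp (L * (x - a))"
proof -
  define H where "H x = exp (- L * (x - a)) * (c + L * integral {a..x} w)" for x
  have dH: "(H has_real_derivative exp (- L * (t - a)) * (L * (w t - (c + L * integral {a..t} w)))) (at t within {a..b})"
    if "t \<in> {a..b}" for t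
    unfolding H_def
    by (rule derivative_eq_intros integral_has_real_derivative[OF w that] refl | simp add: algebra_simps)+
  have "H x \<le> H a"
  proof (rule DERIV_nonpos_imp_decreasing_open[where f = H])
    show "a \<le> x" using x by auto
    show "\<exists>y. (H has_real_derivative y) (at t) \<and> y \<le> 0" if "a < t" "t < x" for t
    proof (intro exI conjI)
      show "(H has_real_derivative exp (- L * (t - a)) * (L * (w t - (c + L * integral {a..t} w)))) (at t)"
        using dH[of t] that x by (simp add: at_within_Icc_at)
      show "exp (- L * (t - a)) * (L * (w t - (c + L * integral {a..t} w))) \<le> 0"
        using le[of t] that x L by (intro mult_nonneg_nonpos) auto
    qed
    show "continuous_on {a..x} H"
      using continuous_on_subset[OF DERIV_continuous_on[OF dH]] x by simp
  qed
  then have "c + L * integral {a..x} w \<le> c * exp (L * (x - a))"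
  proof -
    assume "H x \<le> H a"
    then have "exp (L * (x - a)) * H x \<le> exp (L * (x - a)) * H a" by (intro mult_left_mono) auto
    moreover have "exp (L * (x - a)) * H x = c + L * integral {a..x} w"
      by (simp add: H_def mult.assoc[symmetric] mult_exp_exp)
    moreover have "H a = c" by (simp add: H_def)
    ultimately show ?thesis by (metis mult.commute)
  qed
  with le[OF x] show ?thesis by simp
qed

text \<open>The library's integration by parts needs derivatives off a countable set, which bounded measurable
  potentials do not provide. Here the defect over \<open>[x, y]\<close> is \<open>O((y - x)\<^sup>2)\<close>, hence has zero derivative.\<close>

lemma integral_by_parts_bounded:
  fixes F G F' G' :: "real \<Rightarrow> real"
  assumes F: "\<And>x y. a \<le> x \<Longrightarrow> x \<le> y \<Longrightarrow> y \<le> b \<Longrightarrow> (F' has_integral (F y - F x)) {x..y}"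
    and G: "\<And>x y. a \<le> x \<Longrightarrow> x \<le> y \<Longrightarrow> y \<le> b \<Longrightarrow> (G' has_integral (G y - G x)) {x..y}"
    and F': "\<And>x. x \<in> {a..b} \<Longrightarrow> \<bar>F' x\<bar> \<le> M" and G': "\<And>x. x \<in> {a..b} \<Longrightarrow> \<bar>G' x\<bar> \<le> M"
    and int: "(\<lambda>x. F' x * G x + F x * G' x) integrable_on {a..b}" and ab: "a \<le> b"
  shows "((\<lambda>x. F' x * G x + F x * G' x) has_integral (F b * G b - F a * G a)) {a..b}"
proof -
  let ?h = "\<lambda>x. F' x * G x + F x * G' x"
  have M: "0 \<le> M" using F'[of a] ab by auto
  have lipF: "\<bar>F y - F x\<bar> \<le> M * (y - x)" if "a \<le> x" "x \<le> y" "y \<le> b" for x y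
    using has_integral_bound_real[OF M finite.emptyI F[OF that]] F' that by simp
  have lipG: "\<bar>G y - G x\<bar> \<le> M * (y - x)" if "a \<le> x" "x \<le> y" "y \<le> b" for x y
    using has_integral_bound_real[OF M finite.emptyI G[OF that]] G' that by simp
  have inth: "?h integrable_on {x..y}" if "a \<le> x" "x \<le> y" "y \<le> b" for x y
    using int by (rule integrable_on_subinterval) (use that in auto)
  define D where "D x = F x * G x - integral {a..x} ?h" for x
  \<comment> \<open>With \<open>G\<close> frozen at \<open>y\<close> and \<open>F\<close> at
    \<open>x\<close>, the increment of \<open>F * G\<close> is an exact integral. Unfreezing costs
    the Lipschitz bound \<open>M * (y - x)\<close> times a bounded derivative, integrated over
    length \<open>y - x\<close>.\<close>
  have est: "\<bar>D y - D x\<bar> \<le> 2 * M^2 * (y - x)^2" if xy: "a \<le> x" "x \<le> y" "y \<le> b" for x y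
  proof -
    have 1: "integral {a..y} ?h - integral {a..x} ?h = integral {x..y} ?h"
      using Henstock_Kurzweil_Integration.integral_combine[of a x y ?h] inth[of a y] xy by simp
    have "((\<lambda>t. F' t * G y + F x * G' t - ?h t) has_integral
        ((F y - F x) * G y + F x * (G y - G x) - integral {x..y} ?h)) {x..y}"
      by (intro has_integral_diff has_integral_add has_integral_mult_left has_integral_mult_right
          F G xy integrable_integral inth)
    moreover have "D y - D x = (F y - F x) * G y + F x * (G y - G x) - integral {x..y} ?h"
      unfolding 1[symmetric] D_def by (simp add: algebra_simps)
    ultimately have hi: "((\<lambda>t. F' t * G y + F x * G' t - ?h t) has_integral (D y - D x)) {x..y}" by simp
    have bd: "\<bar>F' t * G y + F x * G' t - ?h t\<bar> \<le> 2 * M^2 * (y - x)" if t: "t \<in> {x..y}" for t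
    proof -
      have "F' t * G y + F x * G' t - ?h t = F' t * (G y - G t) - (F t - F x) * G' t" by (simp add: algebra_simps)
      also have "\<bar>\<dots>\<bar> \<le> \<bar>F' t\<bar> * \<bar>G y - G t\<bar> + \<bar>F t - F x\<bar> * \<bar>G' t\<bar>"
        by (metis abs_mult abs_triangle_ineq4)
      also have "\<dots> \<le> M * (M * (y - x)) + (M * (y - x)) * M"
      proof (intro add_mono mult_mono)
        show "\<bar>G y - G t\<bar> \<le> M * (y - x)"
          using lipG[of t y] t xy mult_left_mono[OF _ M, of "y - t" "y - x"] by force
        show "\<bar>F t - F x\<bar> \<le> M * (y - x)"
          using lipF[of x t] t xy mult_left_mono[OF _ M, of "t - x" "y - x"] by force
      qed (use F' G' t xy M in auto)
      finally show ?thesis by (simp add: power2_eq_square algebra_simps)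
    qed
    have "\<bar>D y - D x\<bar> \<le> 2 * M^2 * (y - x) * (y - x)"
      using has_integral_bound_real[OF _ finite.emptyI hi, of "2 * M^2 * (y - x)"] bd xy by simp
    then show ?thesis by (simp add: power2_eq_square mult_ac)
  qed
  have est': "\<bar>D y - D x\<bar> \<le> 2 * M^2 * (y - x)^2" if "x \<in> {a..b}" "y \<in> {a..b}" for x y
    using est[of x y] est[of y x] that by (cases "x \<le> y") (auto simp: abs_minus_commute power2_commute)
  have "(D has_real_derivative 0) (at x within {a..b})" if x: "x \<in> {a..b}" for x
  proof -
    have "((\<lambda>y. (D y - D x) / (y - x)) \<longlongrightarrow> 0) (at x within {a..b})"
    proof (rule Lim_null_comparison)
      show "\<forall>\<^sub>F y in at x within {a..b}. norm ((D y - D x) / (y - x)) \<le> 2 * M^2 * \<bar>y - x\<bar>"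
        unfolding eventually_at_filter
      proof (intro always_eventually allI impI)
        fix y assume "y \<noteq> x" "y \<in> {a..b}"
        then show "norm ((D y - D x) / (y - x)) \<le> 2 * M^2 * \<bar>y - x\<bar>"
          using est'[OF x, of y] by (simp add: divide_le_eq power2_eq_square mult.assoc abs_mult_self_eq)
      qed
      have "((\<lambda>y. 2 * M^2 * \<bar>y - x\<bar>) \<longlongrightarrow> 2 * M^2 * \<bar>x - x\<bar>) (at x within {a..b})"
        by (intro tendsto_intros)
      then show "((\<lambda>y. 2 * M^2 * \<bar>y - x\<bar>) \<longlongrightarrow> 0) (at x within {a..b})" by simp
    qed
    then show ?thesis by (simp add: has_field_derivative_iff)
  qed
  then have "D b = D a"
    using has_field_derivative_zero_constant[of "{a..b}" D] ab by fastforce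
  then have "integral {a..b} ?h = F b * G b - F a * G a" by (simp add: D_def)
  with integrable_integral[OF int] show ?thesis by simp
qed

section \<open>Integrated solutions of the Schroedinger equation: existence, stability,
  Wronskian\<close>

text \<open>Caratheodory solutions of \<open>f'' = q f\<close> on a set, with \<open>p = f'\<close>, in integrated form:
  \<open>p\<close> need not be differentiable anywhere in particular, so the derivative is only
  ever used through its integrals.\<close>

definition schr_sol :: "(real \<Rightarrow> real) \<Rightarrow> real set \<Rightarrow> (real \<Rightarrow> real) \<Rightarrow> (real \<Rightarrow> real) \<Rightarrow> bool" where
  "schr_sol q S f p \<longleftrightarrow> (\<forall>x y. x \<le> y \<longrightarrow> {x..y} \<subseteq> S \<longrightarrow>
     (p has_integral (f y - f x)) {x..y} \<and> ((\<lambda>t. q t * f t) has_integral (p y - p x)) {x..y})"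

lemma schr_solD:
  assumes "schr_sol q S f p" "x \<le> y" "{x..y} \<subseteq> S"
  shows "(p has_integral (f y - f x)) {x..y}" "((\<lambda>t. q t * f t) has_integral (p y - p x)) {x..y}"
  using assms by (auto simp: schr_sol_def)

lemma schr_sol_subset: "schr_sol q S f p \<Longrightarrow> T \<subseteq> S \<Longrightarrow> schr_sol q T f p"
  by (force simp: schr_sol_def)

lemma schr_sol_cong:
  assumes s: "schr_sol q S f p" and eq: "\<And>x. x \<in> S \<Longrightarrow> q x = r x" "\<And>x. x \<in> S \<Longrightarrow> f x = f' x" "\<And>x. x \<in> S \<Longrightarrow> p x = p' x"
  shows "schr_sol r S f' p'"
  unfolding schr_sol_def
proof (intro allI impI)
  fix x y :: real assume xy: "x \<le> y" "{x..y} \<subseteq> S"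
  then have S: "x \<in> S" "y \<in> S" "\<And>t. t \<in> {x..y} \<Longrightarrow> t \<in> S" by auto
  show "(p' has_integral f' y - f' x) {x..y} \<and> ((\<lambda>t. r t * f' t) has_integral p' y - p' x) {x..y}"
    using has_integral_eq[OF _ schr_solD(1)[OF s xy], of p'] has_integral_eq[OF _ schr_solD(2)[OF s xy], of "\<lambda>t. r t * f' t"]
      eq S by auto
qed

text \<open>An interval containing \<open>c\<close> is split there and the integrals are added. This
  later glues exponential tails to a solution on \<open>{-R..R}\<close>: at a junction only the
  values of \<open>f\<close> and \<open>p\<close> have to agree.\<close>

lemma schr_sol_join:
  assumes 1: "schr_sol q {x \<in> S. x \<le> c} f p" and 2: "schr_sol q {x \<in> S. c \<le> x} f p"
  shows "schr_sol q S f p"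
  unfolding schr_sol_def
proof (intro allI impI)
  fix x y :: real assume xy: "x \<le> y" "{x..y} \<subseteq> S"
  consider "y \<le> c" | "c \<le> x" | "x \<le> c" "c \<le> y" by linarith
  then show "(p has_integral f y - f x) {x..y} \<and> ((\<lambda>t. q t * f t) has_integral p y - p x) {x..y}"
  proof cases
    case 1
    then have "{x..y} \<subseteq> {x \<in> S. x \<le> c}" using xy by auto
    then show ?thesis using schr_solD[OF assms(1) xy(1)] by blast
  next
    case 2
    then have "{x..y} \<subseteq> {x \<in> S. c \<le> x}" using xy by auto
    then show ?thesis using schr_solD[OF assms(2) xy(1)] by blast
  next
    case 3
    have "{x..c} \<subseteq> {x \<in> S. x \<le> c}" "{c..y} \<subseteq> {x \<in> S. c \<le> x}" using 3 xy by auto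
    note sub = this
    from has_integral_combine[OF 3 schr_solD(1)[OF 1 3(1) sub(1)] schr_solD(1)[OF 2 3(2) sub(2)]]
      has_integral_combine[OF 3 schr_solD(2)[OF 1 3(1) sub(1)] schr_solD(2)[OF 2 3(2) sub(2)]]
    show ?thesis by simp
  qed
qed

lemma schr_sol_continuous:
  assumes "schr_sol q {a..b} f p"
  shows "continuous_on {a..b} f" "continuous_on {a..b} p"
proof -
  have *: "continuous_on {a..b} F" if h: "\<And>x. x \<in> {a..b} \<Longrightarrow> (g has_integral F x - F a) {a..x}" for F g :: "real \<Rightarrow> real"
  proof (cases "a \<le> b")
    case True
    then have "g integrable_on {a..b}" using h[of b] by auto
    from indefinite_integral_continuous_1[OF this] have "continuous_on {a..b} (\<lambda>x. F a + integral {a..x} g)"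
      by (intro continuous_intros)
    then show ?thesis
      by (rule continuous_on_eq) (use integral_unique[OF h] in auto)
  qed auto
  show "continuous_on {a..b} f" by (rule *) (auto intro!: schr_solD[OF assms])
  show "continuous_on {a..b} p" by (rule *) (auto intro!: schr_solD[OF assms])
qed

text \<open>Picard iteration for the first-order system (f, p)' = (p, q f) on pairs, whose
  right-hand side is Lipschitz with constant \<open>1 + M\<close>.\<close>

lemma schr_sol_exists:
  assumes q: "q \<in> borel_measurable borel" "\<And>x. \<bar>q x\<bar> \<le> M" and ab: "a \<le> b"
  obtains f p where "schr_sol q {a..b} f p" "f a = A" "p a = B"
proof -
  have M: "0 \<le> M" using q(2)[of 0] by linarith
  define G where "G t y = (snd y, q t * fst y)" for t and y :: "real \<times> real"
  have Pint: "((\<lambda>t. (f t, g t)) has_integral (i, j)) S"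
    if "(f has_integral i) S" "(g has_integral j) S" for f g :: "real \<Rightarrow> real" and i j S
  proof -
    have "((\<lambda>t. (f t, 0) + (0, g t)) has_integral (i, 0) + (0, j)) S"
      using has_integral_linear[OF that(1) bounded_linear_Pair[OF bounded_linear_ident bounded_linear_zero]]
        has_integral_linear[OF that(2) bounded_linear_Pair[OF bounded_linear_zero bounded_linear_ident]]
      unfolding o_def by (rule has_integral_add)
    then show ?thesis by simp
  qed
  have int: "(\<lambda>t. G t (y t)) integrable_on {a..b}" if "continuous_on {a..b} y" for y
  proof -
    have "continuous_on {a..b} (\<lambda>t. fst (y t))" "continuous_on {a..b} (\<lambda>t. snd (y t))"
      using that by (auto intro: continuous_intros)
    then obtain i j where "((\<lambda>t. snd (y t)) has_integral i) {a..b}" "((\<lambda>t. q t * fst (y t)) has_integral j) {a..b}"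
      using integrable_on_bounded_times_continuous[OF q] integrable_continuous_real unfolding integrable_on_def by metis
    from Pint[OF this] show ?thesis by (auto simp: G_def)
  qed
  have lip: "norm (G t y - G t z) \<le> (1 + M) * norm (y - z)" for t y z
  proof -
    have "G t y - G t z = (snd (y - z), q t * fst (y - z))" by (simp add: G_def algebra_simps)
    also have "norm \<dots> \<le> norm (snd (y - z)) + norm (q t * fst (y - z))" by (rule norm_Pair_le)
    also have "\<dots> \<le> norm (y - z) + M * norm (y - z)"
      using q(2)[of t] M norm_fst_le[of "fst (y - z)" "snd (y - z)", unfolded prod.collapse] norm_snd_le[of "snd (y - z)" "fst (y - z)", unfolded prod.collapse]
      unfolding norm_mult by (intro add_mono mult_mono) simp_all
    finally show ?thesis by (simp add: algebra_simps)
  qed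
  from picard_existence[of G "1 + M" a b "(A, B)", OF lip _ int] M
  obtain y where cy: "continuous_on {a..b} y"
    and y: "\<And>x. x \<in> {a..b} \<Longrightarrow> y x = (A, B) + integral {a..x} (\<lambda>t. G t (y t))" by auto
  have hi: "((\<lambda>t. G t (y t)) has_integral (y v - y u)) {u..v}" if "u \<le> v" "{u..v} \<subseteq> {a..b}" for u v
  proof -
    have uv: "u \<in> {a..b}" "v \<in> {a..b}" using that by auto
    have "(\<lambda>t. G t (y t)) integrable_on {a..v}" "(\<lambda>t. G t (y t)) integrable_on {u..v}"
      using int[OF cy] uv that by (auto intro: integrable_on_subinterval)
    with Henstock_Kurzweil_Integration.integral_combine[of a u v "\<lambda>t. G t (y t)"] uv that y[OF uv(1)] y[OF uv(2)]
    show ?thesis by (simp add: has_integral_iff algebra_simps)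
  qed
  show ?thesis
  proof (rule that[of "\<lambda>x. fst (y x)" "\<lambda>x. snd (y x)"])
    show "schr_sol q {a..b} (\<lambda>x. fst (y x)) (\<lambda>x. snd (y x))"
      unfolding schr_sol_def
    proof (intro allI impI)
      fix u v :: real assume uv: "u \<le> v" "{u..v} \<subseteq> {a..b}"
      show "((\<lambda>x. snd (y x)) has_integral fst (y v) - fst (y u)) {u..v} \<and>
           ((\<lambda>t. q t * fst (y t)) has_integral snd (y v) - snd (y u)) {u..v}"
        using has_integral_linear[OF hi[OF uv] bounded_linear_fst] has_integral_linear[OF hi[OF uv] bounded_linear_snd]
        by (simp add: o_def G_def)
    qed
    show "fst (y a) = A" "snd (y a) = B" using y[of a] ab by auto
  qed
qed

text \<open>Gronwall for the sum of the two distances. The splitting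
  \<open>q2 * (f1 - f2) + (q1 - q2) * f1\<close> asks for an a priori bound on the first solution
  alone, so the first slot is meant for the fixed solution and the second for the perturbed
  one.\<close>

lemma schr_sol_compare:
  assumes s1: "schr_sol q1 {a..b} f1 p1" and s2: "schr_sol q2 {a..b} f2 p2"
    and q2: "\<And>x. \<bar>q2 x\<bar> \<le> M" and q12: "\<And>x. \<bar>q1 x - q2 x\<bar> \<le> \<delta>"
    and f1: "\<And>x. x \<in> {a..b} \<Longrightarrow> \<bar>f1 x\<bar> \<le> B" and x: "x \<in> {a..b}"
  shows "\<bar>f1 x - f2 x\<bar> + \<bar>p1 x - p2 x\<bar> \<le>
     (\<bar>f1 a - f2 a\<bar> + \<bar>p1 a - p2 a\<bar> + \<delta> * B * (b - a)) * exp ((1 + M) * (b - a))"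
proof -
  have M: "0 \<le> M" using q2[of 0] by linarith
  have d: "0 \<le> \<delta>" using q12[of 0] by linarith
  have B: "0 \<le> B" using f1[OF x] by linarith
  define w where "w x = \<bar>f1 x - f2 x\<bar> + \<bar>p1 x - p2 x\<bar>" for x
  define c where "c = \<bar>f1 a - f2 a\<bar> + \<bar>p1 a - p2 a\<bar> + \<delta> * B * (b - a)"
  note cont = schr_sol_continuous[OF s1] schr_sol_continuous[OF s2]
  have w: "continuous_on {a..b} w" unfolding w_def by (intro continuous_intros cont)
  have wi: "w integrable_on {a..x}" if "x \<in> {a..b}" for x
    by (rule integrable_continuous_real, rule continuous_on_subset[OF w]) (use that in auto)
  have le: "w x \<le> c + (1 + M) * integral {a..x} w" if x: "x \<in> {a..b}" for x
  proof -
    have ax: "a \<le> x" "{a..x} \<subseteq> {a..b}" using x by auto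
    have i1: "((\<lambda>t. p1 t - p2 t) has_integral ((f1 x - f1 a) - (f2 x - f2 a))) {a..x}"
      by (intro has_integral_diff schr_solD[OF s1] schr_solD[OF s2] ax)
    have i2: "((\<lambda>t. q1 t * f1 t - q2 t * f2 t) has_integral ((p1 x - p1 a) - (p2 x - p2 a))) {a..x}"
      by (intro has_integral_diff schr_solD[OF s1] schr_solD[OF s2] ax)
    have ci: "(\<lambda>t. \<bar>p1 t - p2 t\<bar>) integrable_on {a..x}" "(\<lambda>t. M * \<bar>f1 t - f2 t\<bar> + \<delta> * B) integrable_on {a..x}"
      by (rule integrable_continuous_real, rule continuous_on_subset[of "{a..b}"], intro continuous_intros cont, use x in auto)+
    have b1: "\<bar>(f1 x - f1 a) - (f2 x - f2 a)\<bar> \<le> integral {a..x} (\<lambda>t. \<bar>p1 t - p2 t\<bar>)"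
      using Henstock_Kurzweil_Integration.integral_norm_bound_integral[OF has_integral_integrable[OF i1] ci(1)]
      by (simp add: integral_unique[OF i1])
    have "norm (q1 t * f1 t - q2 t * f2 t) \<le> M * \<bar>f1 t - f2 t\<bar> + \<delta> * B" if t: "t \<in> {a..x}" for t
    proof -
      have "q1 t * f1 t - q2 t * f2 t = q2 t * (f1 t - f2 t) + (q1 t - q2 t) * f1 t" by (simp add: algebra_simps)
      also have "norm \<dots> \<le> \<bar>q2 t\<bar> * \<bar>f1 t - f2 t\<bar> + \<bar>q1 t - q2 t\<bar> * \<bar>f1 t\<bar>"
        unfolding real_norm_def abs_mult[symmetric] by (rule abs_triangle_ineq)
      also have "\<dots> \<le> M * \<bar>f1 t - f2 t\<bar> + \<delta> * B"
        using q2 q12 f1[of t] t x M d by (intro add_mono mult_mono) auto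
      finally show ?thesis .
    qed
    then have b2: "\<bar>(p1 x - p1 a) - (p2 x - p2 a)\<bar> \<le> integral {a..x} (\<lambda>t. M * \<bar>f1 t - f2 t\<bar> + \<delta> * B)"
      using Henstock_Kurzweil_Integration.integral_norm_bound_integral[OF has_integral_integrable[OF i2] ci(2)]
      by (simp add: integral_unique[OF i2])
    have "integral {a..x} (\<lambda>t. \<bar>p1 t - p2 t\<bar>) + integral {a..x} (\<lambda>t. M * \<bar>f1 t - f2 t\<bar> + \<delta> * B)
       = integral {a..x} (\<lambda>t. \<bar>p1 t - p2 t\<bar> + (M * \<bar>f1 t - f2 t\<bar> + \<delta> * B))"
      by (rule Henstock_Kurzweil_Integration.integral_add[symmetric]) (rule ci)+
    also have "\<dots> \<le> integral {a..x} (\<lambda>t. (1 + M) * w t + \<delta> * B)"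
    proof (rule integral_le)
      show "(\<lambda>t. (1 + M) * w t + \<delta> * B) integrable_on {a..x}"
        by (intro integrable_add integrable_on_mult_right wi x) auto
      show "\<bar>p1 t - p2 t\<bar> + (M * \<bar>f1 t - f2 t\<bar> + \<delta> * B) \<le> (1 + M) * w t + \<delta> * B" for t
        using M by (simp add: w_def algebra_simps)
    qed (intro integrable_add ci)
    also have "\<dots> = (1 + M) * integral {a..x} w + \<delta> * B * (x - a)"
      using x by (subst Henstock_Kurzweil_Integration.integral_add) (auto intro!: integrable_on_mult_right wi)
    also have "\<dots> \<le> (1 + M) * integral {a..x} w + \<delta> * B * (b - a)"
      using x d B by (intro add_left_mono mult_left_mono) auto
    finally show ?thesis using b1 b2 unfolding w_def c_def by linarith
  qed
  have "w x \<le> c * exp ((1 + M) * (x - a))"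
    using gronwall[OF w _ le x] M by simp
  also have "\<dots> \<le> c * exp ((1 + M) * (b - a))"
    using x M d B by (intro mult_left_mono) (auto simp: c_def)
  finally show ?thesis by (simp add: w_def c_def)
qed

text \<open>Formally the derivative of \<open>f1 * p2 - p1 * f2\<close> is
  \<open>(q2 - q1) * f1 * f2\<close>, as the terms \<open>p1 * p2\<close> cancel. Since
  \<open>p1\<close> and \<open>p2\<close> may fail to be differentiable at a given point, this is
  obtained by subtracting two integrations by parts.\<close>

lemma schr_sol_wronskian:
  assumes s1: "schr_sol q1 {a..b} f1 p1" and s2: "schr_sol q2 {a..b} f2 p2"
    and q1: "q1 \<in> borel_measurable borel" "\<And>x. \<bar>q1 x\<bar> \<le> M" 
    and q2: "q2 \<in> borel_measurable borel" "\<And>x. \<bar>q2 x\<bar> \<le> M" and ab: "a \<le> b"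
  shows "((\<lambda>t. (q2 t - q1 t) * (f1 t * f2 t)) has_integral
     (f1 b * p2 b - p1 b * f2 b - (f1 a * p2 a - p1 a * f2 a))) {a..b}"
proof -
  note cont = schr_sol_continuous[OF s1] schr_sol_continuous[OF s2]
  have M: "0 \<le> M" using q2(2)[of 0] by linarith
  from cont[THEN continuous_on_Icc_bounded] obtain C1 C2 C3 C4 where C:
    "\<And>x. x \<in> {a..b} \<Longrightarrow> \<bar>f1 x\<bar> \<le> C1" "\<And>x. x \<in> {a..b} \<Longrightarrow> \<bar>p1 x\<bar> \<le> C2"
    "\<And>x. x \<in> {a..b} \<Longrightarrow> \<bar>f2 x\<bar> \<le> C3" "\<And>x. x \<in> {a..b} \<Longrightarrow> \<bar>p2 x\<bar> \<le> C4" by metis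
  have C0: "0 \<le> C1" "0 \<le> C2" "0 \<le> C3" "0 \<le> C4" using C[of a] ab by auto
  \<comment> \<open>One common bound for \<open>p1\<close>, \<open>p2\<close> and the two products
    \<open>q1 * f1\<close> and \<open>q2 * f2\<close>, which are the four derivatives entering the
    integrations by parts.\<close>
  define K where "K = C2 + C4 + M * C1 + M * C3"
  have K: "C2 \<le> K" "C4 \<le> K" "M * C1 \<le> K" "M * C3 \<le> K" using M C0 by (auto simp: K_def)
  have qb: "\<bar>q1 x * f1 x\<bar> \<le> K" "\<bar>q2 x * f2 x\<bar> \<le> K" if "x \<in> {a..b}" for x
    using mult_mono[OF q1(2)[of x] C(1)[OF that]] mult_mono[OF q2(2)[of x] C(3)[OF that]] K M 
    by (auto simp: abs_mult)
  have pp: "(\<lambda>x. p1 x * p2 x) integrable_on {a..b}"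
    by (intro integrable_continuous_real continuous_intros cont)
  have i1: "(\<lambda>x. q1 x * (f1 x * f2 x)) integrable_on {a..b}" and i2: "(\<lambda>x. q2 x * (f1 x * f2 x)) integrable_on {a..b}"
    by (intro integrable_on_bounded_times_continuous[OF q1] integrable_on_bounded_times_continuous[OF q2] continuous_intros cont)+
  have "((\<lambda>x. p1 x * p2 x + f1 x * (q2 x * f2 x)) has_integral (f1 b * p2 b - f1 a * p2 a)) {a..b}"
  proof (rule integral_by_parts_bounded[where M = K])
    show "(\<lambda>x. p1 x * p2 x + f1 x * (q2 x * f2 x)) integrable_on {a..b}"
      using integrable_add[OF pp i2] by (simp add: mult_ac)
    show "\<And>x y. a \<le> x \<Longrightarrow> x \<le> y \<Longrightarrow> y \<le> b \<Longrightarrow> (p1 has_integral f1 y - f1 x) {x..y}"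
      "\<And>x y. a \<le> x \<Longrightarrow> x \<le> y \<Longrightarrow> y \<le> b \<Longrightarrow> ((\<lambda>t. q2 t * f2 t) has_integral p2 y - p2 x) {x..y}"
      by (intro schr_solD[OF s1] schr_solD[OF s2]; simp)+
    show "\<bar>p1 x\<bar> \<le> K" if "x \<in> {a..b}" for x using that C(2) K(1) qb(1) order_trans by blast
    show "\<bar>q2 x * f2 x\<bar> \<le> K" if "x \<in> {a..b}" for x using that C(4) K(2) qb(2) order_trans by blast
  qed (rule ab)
  moreover have "((\<lambda>x. (q1 x * f1 x) * f2 x + p1 x * p2 x) has_integral (p1 b * f2 b - p1 a * f2 a)) {a..b}"
  proof (rule integral_by_parts_bounded[where M = K])
    show "(\<lambda>x. (q1 x * f1 x) * f2 x + p1 x * p2 x) integrable_on {a..b}"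
      using integrable_add[OF i1 pp] by (simp add: mult_ac)
    show "\<And>x y. a \<le> x \<Longrightarrow> x \<le> y \<Longrightarrow> y \<le> b \<Longrightarrow> ((\<lambda>t. q1 t * f1 t) has_integral p1 y - p1 x) {x..y}"
      "\<And>x y. a \<le> x \<Longrightarrow> x \<le> y \<Longrightarrow> y \<le> b \<Longrightarrow> (p2 has_integral f2 y - f2 x) {x..y}"
      by (intro schr_solD[OF s1] schr_solD[OF s2]; simp)+
    show "\<bar>q1 x * f1 x\<bar> \<le> K" if "x \<in> {a..b}" for x using that C(2) K(1) qb(1) order_trans by blast
    show "\<bar>p2 x\<bar> \<le> K" if "x \<in> {a..b}" for x using that C(4) K(2) qb(2) order_trans by blast
  qed (rule ab)
  ultimately show ?thesis
    by - (drule (1) has_integral_diff, simp add: algebra_simps)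
qed

section \<open>Representatives of the potentials and the shape of the half-bound state\<close>

text \<open>The estimates for solutions use bounds and supports valid at every point. Setting the
  function to 0 wherever the almost-everywhere conditions fail achieves this and changes it only on
  a null set.\<close>

lemma Linf_compact_representative:
  assumes "Linf_compact U"
  obtains U0 M R where "U0 \<in> borel_measurable borel" "\<And>x. \<bar>U0 x\<bar> \<le> M" "\<And>x. R < \<bar>x\<bar> \<Longrightarrow> U0 x = 0"
    "AE x in lborel. U x = U0 x"
proof -
  from assms obtain M R where U: "U \<in> borel_measurable borel" "AE x in lborel. \<bar>U x\<bar> \<le> M"
    "AE x in lborel. R < \<bar>x\<bar> \<longrightarrow> U x = 0" by (auto simp: Linf_compact_def)
  show ?thesis
  proof (rule that[of "\<lambda>x. if \<bar>x\<bar> \<le> R \<and> \<bar>U x\<bar> \<le> M then U x else 0" "\<bar>M\<bar>" R])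
    show "(\<lambda>x. if \<bar>x\<bar> \<le> R \<and> \<bar>U x\<bar> \<le> M then U x else 0) \<in> borel_measurable borel" using U(1) by measurable
    show "AE x in lborel. U x = (if \<bar>x\<bar> \<le> R \<and> \<bar>U x\<bar> \<le> M then U x else 0)"
      using U(2,3) by eventually_elim auto
  qed auto
qed

text \<open>Outside the support the solution is affine, and a bounded affine function on a half-line
  is constant. Hence the limits at infinity are attained at \<open>-R\<close> and \<open>R\<close>,
  with zero slope there.\<close>

lemma half_bound_state_normal_form:
  assumes hbs: "half_bound_state U u" and U0: "AE x in lborel. U x = U0 x" "\<And>x. R \<le> \<bar>x\<bar> \<Longrightarrow> U0 x = 0" and R: "0 \<le> R"
    and l: "(u \<longlongrightarrow> \<theta>1) at_bot" and r: "(u \<longlongrightarrow> \<theta>2) at_top"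
  obtains u' where "schr_sol U0 UNIV u u'" "\<And>x. (u has_real_derivative u' x) (at x)"
    "u (-R) = \<theta>1" "u' (-R) = 0" "u R = \<theta>2" "u' R = 0"
proof -
  from hbs obtain u' g where g: "second_deriv u u' g" "AE x in lborel. - g x + U x * u x = 0"
    and "bounded (range u)"
    unfolding half_bound_state_def by blast
  then obtain B where "\<forall>y\<in>range u. norm y \<le> B" unfolding bounded_iff by blast
  then have B: "\<bar>u x\<bar> \<le> B" for x by simp
  have du: "(u has_real_derivative u' x) (at x)" and gi: "set_integrable lborel {a..b} g"
    and u': "u' x = u' 0 + (LBINT t=0..x. g t)" for x a b
    using g(1) unfolding second_deriv_def by blast+
  have gint: "g integrable_on {a..b}" for a b using set_borel_integral_eq_integral(1)[OF gi] .
  \<comment> \<open>The integral in \<open>second_deriv\<close> is oriented, so both signs of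
    \<open>x\<close> have to be treated before increments over \<open>{x..y}\<close> can be
    formed.\<close>
  have J: "u' x = u' 0 + (if 0 \<le> x then integral {0..x} g else - integral {x..0} g)" for x
    using interval_integral_eq_integral[OF _ gi, of 0 x] interval_integral_eq_integral[OF _ gi, of x 0]
      interval_integral_endpoints_reverse[of 0 x g] u'[of x] by (auto simp: zero_ereal_def)
  have hi: "(g has_integral (u' y - u' x)) {x..y}" if "x \<le> y" for x y
  proof -
    have "u' y - u' x = integral {x..y} g"
      using Henstock_Kurzweil_Integration.integral_combine[OF _ _ gint, of 0 x y]
        Henstock_Kurzweil_Integration.integral_combine[OF _ _ gint, of x 0 y]
        Henstock_Kurzweil_Integration.integral_combine[OF _ _ gint, of x y 0] that
      unfolding J[of x] J[of y] by auto
    with gint[of x y] show ?thesis by (simp add: has_integral_iff)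
  qed
  have ae: "AE x in lborel. g x = U0 x * u x" using g(2) U0(1) by eventually_elim auto
  have sol: "schr_sol U0 UNIV u u'"
    unfolding schr_sol_def
  proof (intro allI impI conjI)
    fix x y :: real assume xy: "x \<le> y"
    show "(u' has_integral u y - u x) {x..y}"
      by (intro fundamental_theorem_of_calculus xy)
        (auto simp: has_real_derivative_iff_has_vector_derivative[symmetric] intro: has_field_derivative_at_within du)
    show "((\<lambda>t. U0 t * u t) has_integral u' y - u' x) {x..y}"
      using hi[OF xy] ae by (subst has_integral_AE[of _ _ g]) auto
  qed
  \<comment> \<open>The disjunction lets the slope be read off at either end: at the right end for
    the half-line left of \<open>-R\<close>, at the left end for the one right of
    \<open>R\<close>.\<close>
  have lin: "u' x = c" "u y - u x = c * (y - x)" if "x \<le> y" "\<And>t. t \<in> {x..y} \<Longrightarrow> U0 t = 0" "c = u' x \<or> c = u' y" for x y c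
  proof -
    have *: "u' b = u' a" if "a \<le> b" "{a..b} \<subseteq> {x..y}" for a b
    proof -
      have "((\<lambda>t. 0::real) has_integral u' b - u' a) {a..b}"
        using that \<open>\<And>t. t \<in> {x..y} \<Longrightarrow> U0 t = 0\<close>
        by (intro has_integral_eq[OF _ schr_solD(2)[OF sol that(1)]]) auto
      then show ?thesis using has_integral_unique[OF has_integral_0] by fastforce
    qed
    show c: "u' x = c" using *[of x y] that by auto
    have "((\<lambda>t. c) has_integral u y - u x) {x..y}"
      by (rule has_integral_eq[OF _ schr_solD(1)[OF sol that(1)]]) (use *[of x] c in auto)
    from has_integral_unique[OF this has_integral_const_real] that(1)
    show "u y - u x = c * (y - x)" by simp
  qed
  have zero: "c = 0" if "\<And>t. t \<ge> 0 \<Longrightarrow> \<bar>c\<bar> * t \<le> 2 * B" for c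
  proof (rule ccontr)
    assume c: "c \<noteq> 0"
    have "B \<ge> 0" using B[of 0] by linarith
    then show False using that[of "(2 * B + 1) / \<bar>c\<bar>"] c by (simp add: field_simps)
  qed
  have left: "u (-R) - u x = u' (-R) * (-R - x)" if "x \<le> -R" for x
    by (rule lin(2)) (use that R in \<open>auto intro: U0(2)\<close>)
  have right: "u x - u R = u' R * (x - R)" if "R \<le> x" for x
    by (rule lin(2)) (use that R in \<open>auto intro: U0(2)\<close>)
  have z: "u' (-R) = 0" "u' R = 0"
  proof -
    have "\<bar>u' (-R)\<bar> * t \<le> 2 * B" if "t \<ge> 0" for t
    proof -
      have "\<bar>u (-R) - u (-R - t)\<bar> = \<bar>u' (-R)\<bar> * t" using that by (subst left) (auto simp: abs_mult)
      then show ?thesis using B[of "-R"] B[of "-R - t"] by linarith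
    qed
    then show "u' (-R) = 0" by (rule zero)
    have "\<bar>u' R\<bar> * t \<le> 2 * B" if "t \<ge> 0" for t
    proof -
      have "\<bar>u (R + t) - u R\<bar> = \<bar>u' R\<bar> * t" using that by (subst right) (auto simp: abs_mult)
      then show ?thesis using B[of R] B[of "R + t"] by linarith
    qed
    then show "u' R = 0" by (rule zero)
  qed
  have "u x = u (-R)" if "x \<le> -R" for x
    using left[OF that] z by simp
  then have "(u \<longlongrightarrow> u (-R)) at_bot"
    by (intro tendsto_eventually eventually_mono[OF eventually_le_at_bot[of "-R"]])
  then have 1: "u (-R) = \<theta>1" using tendsto_unique[OF trivial_limit_at_bot_linorder _ l] by blast
  have "u x = u R" if "R \<le> x" for x
    using right[OF that] z by simp
  then have "(u \<longlongrightarrow> u R) at_top"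
    by (intro tendsto_eventually eventually_mono[OF eventually_ge_at_top[of R]])
  then have "u R = \<theta>2" using tendsto_unique[OF trivial_limit_at_top_linorder _ r] by blast
  with that sol du 1 z show ?thesis by blast
qed

section \<open>From a matched solution to an eigenfunction\<close>

text \<open>Here \<open>f\<close> is an indefinite integral of \<open>p\<close>, and
  \<open>p\<close>, itself an indefinite integral, is continuous; the fundamental theorem then holds
  at every point.\<close>

lemma schr_sol_UNIV_imp_deriv:
  assumes "schr_sol q UNIV f p"
  shows "(f has_real_derivative p x) (at x)"
proof -
  have sub: "schr_sol q {x-1..x+1} f p" using schr_sol_subset[OF assms] by simp
  have "((\<lambda>y. f (x-1) + integral {x-1..y} p) has_real_derivative p x) (at x within {x-1..x+1})"
    using integral_has_real_derivative[OF schr_sol_continuous(2)[OF sub], of x]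
    by (auto intro!: derivative_eq_intros)
  then have "((\<lambda>y. f (x-1) + integral {x-1..y} p) has_real_derivative p x) (at x)"
    by (simp add: at_within_Icc_at)
  then show ?thesis
  proof (rule DERIV_cong_ev[THEN iffD1, rotated -1])
    show "\<forall>\<^sub>F y in nhds x. f (x-1) + integral {x-1..y} p = f y"
    proof (rule eventually_nhds_in_open[THEN eventually_mono])
      show "f (x-1) + integral {x-1..y} p = f y" if "y \<in> {x-1<..<x+1}" for y
        using integral_unique[OF schr_solD(1)[OF assms, of "x-1" y]] that by simp
    qed auto
  qed auto
qed

lemma schr_sol_UNIV_imp_second_deriv:
  assumes s: "schr_sol q UNIV f p" and q: "q \<in> borel_measurable borel" "\<And>x. \<bar>q x\<bar> \<le> M"
  shows "second_deriv f p (\<lambda>t. q t * f t)"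
  unfolding second_deriv_def
proof (intro conjI allI)
  show "(f has_real_derivative p x) (at x)" for x by (rule schr_sol_UNIV_imp_deriv[OF s])
  show si: "set_integrable lborel {a..b} (\<lambda>t. q t * f t)" for a b
    by (rule set_integrable_bounded_times_continuous[OF q])
      (rule schr_sol_continuous[OF schr_sol_subset[OF s]], simp)
  show "p x = p 0 + (LBINT t=0..x. q t * f t)" for x
    using interval_integral_eq_integral[OF _ si, of 0 x] interval_integral_eq_integral[OF _ si, of x 0]
      interval_integral_endpoints_reverse[of 0 x "\<lambda>t. q t * f t"]
      integral_unique[OF schr_solD(2)[OF s, of 0 x]] integral_unique[OF schr_solD(2)[OF s, of x 0]]
    by (cases "0 \<le> x") (auto simp: zero_ereal_def)
qed

text \<open>The half-line exponential plus its reflection dominates the function; the double count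
  at 0 does no harm.\<close>

lemma integrable_exp_minus_abs:
  fixes c :: real assumes c: "c > 0"
  shows "integrable lborel (\<lambda>x. exp (- c * \<bar>x\<bar>))"
proof -
  let ?g = "\<lambda>x. indicator {0..} x *\<^sub>R exp (- c * x)"
  have "integrable lebesgue ?g"
    using c by (intro nonnegative_absolutely_integrable_1 [unfolded set_integrable_def] integrable_on_exp_minus_to_infinity) auto
  then have g: "integrable lborel ?g" by (subst (asm) integrable_completion) auto
  have "integrable lborel (\<lambda>x. ?g (0 + (-1) * x))" by (rule lborel_integrable_real_affine[OF g]) auto
  then have "integrable lborel (\<lambda>x. ?g x + ?g (0 + (-1) * x))" using g by simp
  then show ?thesis
    by (rule Bochner_Integration.integrable_bound) (auto simp: indicator_def)
qed

lemma square_integrable_exp_decay: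
  assumes f: "f \<in> borel_measurable borel" and le: "\<And>x. \<bar>f x\<bar> \<le> C * exp (- k * \<bar>x\<bar>)" and k: "k > 0"
  shows "square_integrable f"
  unfolding square_integrable_def
proof
  have "integrable lborel (\<lambda>x. C^2 * exp (- (2 * k) * \<bar>x\<bar>))"
    using integrable_exp_minus_abs[of "2 * k"] k by simp
  then show "integrable lborel (\<lambda>x. (f x)\<^sup>2)"
  proof (rule Bochner_Integration.integrable_bound)
    show "AE x in lborel. norm ((f x)\<^sup>2) \<le> norm (C^2 * exp (- (2 * k) * \<bar>x\<bar>))"
    proof (intro AE_I2)
      fix x
      have "(f x)\<^sup>2 \<le> (C * exp (- k * \<bar>x\<bar>))\<^sup>2" using le[of x] by (intro abs_le_square_iff[THEN iffD1]) auto
      also have "\<dots> = C^2 * exp (- (2 * k) * \<bar>x\<bar>)" by (simp add: power_mult_distrib exp_double[symmetric] algebra_simps)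
      finally show "norm ((f x)\<^sup>2) \<le> norm (C^2 * exp (- (2 * k) * \<bar>x\<bar>))" by simp
    qed
  qed (use f in measurable)
qed (use f in simp)

text \<open>The sign of \<open>k\<close> is left free: \<open>k\<close> gives the tail decaying to
  the left, \<open>-k\<close> the one decaying to the right.\<close>

lemma schr_sol_exp:
  assumes "\<And>x. x \<in> S \<Longrightarrow> q x = k\<^sup>2"
  shows "schr_sol q S (\<lambda>x. A * exp (k * x)) (\<lambda>x. k * (A * exp (k * x)))"
  unfolding schr_sol_def
proof (intro allI impI conjI)
  fix x y :: real assume xy: "x \<le> y" "{x..y} \<subseteq> S"
  show "((\<lambda>x. k * (A * exp (k * x))) has_integral A * exp (k * y) - A * exp (k * x)) {x..y}"
    by (intro fundamental_theorem_of_calculus xy)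
      (auto simp: has_real_derivative_iff_has_vector_derivative[symmetric] intro!: derivative_eq_intros)
  have "((\<lambda>x. k\<^sup>2 * (A * exp (k * x))) has_integral k * (A * exp (k * y)) - k * (A * exp (k * x))) {x..y}"
    by (intro fundamental_theorem_of_calculus xy)
      (auto simp: has_real_derivative_iff_has_vector_derivative[symmetric] power2_eq_square intro!: derivative_eq_intros)
  then show "((\<lambda>t. q t * (A * exp (k * t))) has_integral k * (A * exp (k * y)) - k * (A * exp (k * x))) {x..y}"
    by (rule has_integral_eq[rotated]) (use assms xy in auto)
qed

text \<open>The initial data at \<open>-R\<close> match the left exponential, and
  \<open>match\<close> is the condition for the right one to continue both \<open>f\<close> and
  \<open>p\<close> at \<open>R\<close>. The glued solution decays exponentially together with its
  first two derivatives, hence lies in the Sobolev space.\<close>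

lemma schr_eigenvalue_of_matching:
  assumes s: "schr_sol q {-R..R} f p" and q: "q \<in> borel_measurable borel" "\<And>x. \<bar>q x\<bar> \<le> M"
    and out: "\<And>x. R \<le> \<bar>x\<bar> \<Longrightarrow> q x = k\<^sup>2" and k: "k > 0" and R: "R > 0"
    and init: "f (-R) = 1" "p (-R) = k" and match: "p R = - k * f R"
    and W: "AE x in lborel. q x = W x + k\<^sup>2"
  shows "schr_eigenvalue W (- k\<^sup>2)"
proof -
  \<comment> \<open>The prefactors make the left tail equal to 1 at \<open>-R\<close> and the right
    tail equal to \<open>f R\<close> at \<open>R\<close>.\<close>
  define F where "F x = (if x \<le> -R then exp (k * R) * exp (k * x) else if x \<le> R then f x else (f R * exp (k * R)) * exp (- k * x))" for x
  define P where "P x = (if x \<le> -R then k * (exp (k * R) * exp (k * x)) else if x \<le> R then p x else - k * ((f R * exp (k * R)) * exp (- k * x)))" for x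
  have "schr_sol q {..-R} F P"
    by (rule schr_sol_cong[OF schr_sol_exp[of _ q k "exp (k * R)"]]) (use out R in \<open>auto simp: F_def P_def\<close>)
  moreover have "schr_sol q {-R..R} F P"
  proof (rule schr_sol_cong[OF s])
    fix x assume "x \<in> {-R..R}"
    then show "f x = F x" "p x = P x"
      using init by (cases "x = -R"; simp add: F_def P_def mult_exp_exp)+
  qed auto
  moreover have "schr_sol q {R..} F P"
  proof (rule schr_sol_cong[OF schr_sol_exp[of "{R..}" q "-k" "f R * exp (k * R)"]])
    fix x assume "x \<in> {R..}"
    then show "f R * exp (k * R) * exp (- k * x) = F x" "- k * (f R * exp (k * R) * exp (- k * x)) = P x"
      using match R by (cases "x = R"; simp add: F_def P_def mult_exp_exp)+
  qed (use out R in auto)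
  moreover have "{x \<in> {x. x \<le> R}. x \<le> -R} = {..-R}" "{x \<in> {x. x \<le> R}. -R \<le> x} = {-R..R}" "{x. R \<le> x} = {R..}"
    using R by auto
  ultimately have "schr_sol q {x. x \<le> R} F P" "schr_sol q {x \<in> UNIV. R \<le> x} F P"
    using schr_sol_join[of q "{x. x \<le> R}" "-R" F P] by simp_all
  then have sF: "schr_sol q UNIV F P" using schr_sol_join[of q UNIV R F P] by simp
  have cF: "continuous_on UNIV F"
    using schr_sol_UNIV_imp_deriv[OF sF] DERIV_isCont continuous_at_imp_continuous_on by blast
  have cP: "continuous_on UNIV P"
  proof (intro continuous_at_imp_continuous_on ballI)
    fix x
    have "continuous_on {x-1<..<x+1} P"
      by (rule continuous_on_subset[OF schr_sol_continuous(2)[OF schr_sol_subset[OF sF], of "x-1" "x+1"]]) auto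
    then show "isCont P x" by (rule continuous_on_interior) auto
  qed
  have mF: "F \<in> borel_measurable borel" and mP: "P \<in> borel_measurable borel"
    using cF cP by (auto intro: borel_measurable_continuous_onI)
  from schr_sol_continuous[OF s, THEN continuous_on_Icc_bounded] obtain C1 C2 where C1: "\<And>x. x \<in> {-R..R} \<Longrightarrow> \<bar>f x\<bar> \<le> C1"
    and C2: "\<And>x. x \<in> {-R..R} \<Longrightarrow> \<bar>p x\<bar> \<le> C2" by metis
  have C0: "1 \<le> C1" "0 \<le> C2" using C1[of "-R"] C2[of "-R"] R init k by auto
  define C where "C = (1 + k) * (C1 + C2)"
  have C: "C1 \<le> C" "C2 \<le> C" "k * C1 \<le> C" "1 \<le> C" "k \<le> C"
  proof -
    have e: "C = C1 + C2 + k * C1 + k * C2" by (simp add: C_def algebra_simps)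
    have "0 \<le> k * C2" "k * 1 \<le> k * C1" using k C0 by auto
    then show "C1 \<le> C" "C2 \<le> C" "k * C1 \<le> C" "1 \<le> C" "k \<le> C" unfolding e using k C0 by linarith+
  qed
  have dec: "\<bar>F x\<bar> \<le> C * exp (k * R) * exp (- k * \<bar>x\<bar>) \<and> \<bar>P x\<bar> \<le> C * exp (k * R) * exp (- k * \<bar>x\<bar>)" for x
  proof -
    consider "x \<le> -R" | "-R < x" "x \<le> R" | "R < x" by linarith
    then show ?thesis
    proof cases
      case 1
      then have "\<bar>x\<bar> = -x" using R by auto
      moreover have "1 * (exp (k * R) * exp (k * x)) \<le> C * (exp (k * R) * exp (k * x))"
        "k * (exp (k * R) * exp (k * x)) \<le> C * (exp (k * R) * exp (k * x))"
        using C by (intro mult_right_mono; simp)+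
      ultimately show ?thesis using 1 k by (auto simp: F_def P_def abs_mult)
    next
      case 2
      \<comment> \<open>On the middle interval \<open>exp (k * (R - \<bar>x\<bar>))\<close> is at
        least 1, so a constant bound is already of the exponential form.\<close>
      have "C * 1 \<le> C * (exp (k * R) * exp (- k * \<bar>x\<bar>))"
        using C 2 k by (intro mult_left_mono) (auto simp: mult_exp_exp)
      then have "C \<le> C * exp (k * R) * exp (- k * \<bar>x\<bar>)" by (simp only: mult.assoc mult_1_right)
      moreover have "\<bar>F x\<bar> \<le> C" "\<bar>P x\<bar> \<le> C" using 2 C C1[of x] C2[of x] by (auto simp: F_def P_def)
      ultimately show ?thesis by (auto intro: order_trans)
    next
      case 3
      then have "\<bar>x\<bar> = x" using R by auto
      moreover have "\<bar>f R\<bar> * (exp (k * R) * exp (- k * x)) \<le> C * (exp (k * R) * exp (- k * x))"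
        "(k * \<bar>f R\<bar>) * (exp (k * R) * exp (- k * x)) \<le> C * (exp (k * R) * exp (- k * x))"
        using C C1[of R] R order_trans[OF mult_left_mono[of "\<bar>f R\<bar>" C1 k] C(3)] k by (intro mult_right_mono; simp)+
      ultimately show ?thesis using 3 k R by (auto simp: F_def P_def abs_mult mult.assoc)
    qed
  qed
  have M: "0 \<le> M" using q(2)[of 0] by linarith
  have decq: "\<bar>q x * F x\<bar> \<le> (M * C * exp (k * R)) * exp (- k * \<bar>x\<bar>)" for x
    using mult_mono[OF q(2)[of x] conjunct1[OF dec[of x]]] M by (simp add: abs_mult mult.assoc)
  have W22: "in_W22 F P (\<lambda>t. q t * F t)"
    unfolding in_W22_def
  proof (intro conjI)
    show "second_deriv F P (\<lambda>t. q t * F t)" by (rule schr_sol_UNIV_imp_second_deriv[OF sF q])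
    show "square_integrable F" "square_integrable P" "square_integrable (\<lambda>t. q t * F t)"
      using square_integrable_exp_decay[OF mF conjunct1[OF dec] k] square_integrable_exp_decay[OF mP conjunct2[OF dec] k]
        square_integrable_exp_decay[OF borel_measurable_times[OF q(1) mF] decq k] by simp_all
  qed
  \<comment> \<open>The left tail is positive on an interval of length 1, so it cannot vanish almost
    everywhere.\<close>
  have nz: "\<not> (AE x in lborel. F x = 0)"
  proof
    assume "AE x in lborel. F x = 0"
    then have "AE x in lborel. x \<notin> {-R-1..-R}" by eventually_elim (auto simp: F_def)
    then have "{-R-1..-R} \<in> null_sets lborel" by (subst AE_iff_null_sets) auto
    then show False by (auto simp: null_sets_def)
  qed
  have "AE x in lborel. - (q x * F x) + W x * F x = (- k\<^sup>2) * F x"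
    using W by eventually_elim (auto simp: algebra_simps)
  with W22 nz show ?thesis unfolding schr_eigenvalue_def by blast
qed

section \<open>Dipole expansion of the concentrated potential\<close>

text \<open>After the substitution \<open>t = a * x\<close> the constant term of \<open>h\<close> is
  annihilated by the zero mean of \<open>V\<close>, and the linear term yields the first moment
  divided by \<open>a\<close>. The quadratic remainder is at most \<open>K * (R / a)^2\<close> on a
  support of length \<open>2 * R\<close>.\<close>

lemma dipole_integral_estimate:
  fixes V h :: "real \<Rightarrow> real"
  assumes V: "V \<in> borel_measurable borel" "\<And>x. \<bar>V x\<bar> \<le> M" "\<And>x. R \<le> \<bar>x\<bar> \<Longrightarrow> V x = 0"
    and V0: "(LINT x|lborel. V x) = 0" and a: "a \<ge> 1" and R: "R > 0"
    and h: "continuous_on {-R..R} h" "\<And>x. x \<in> {-R..R} \<Longrightarrow> \<bar>h x - h0 - h1 * x\<bar> \<le> K * x\<^sup>2"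
  shows "\<bar>integral {-R..R} (\<lambda>x. a * V (a * x) * h x) - h1 * (LINT x|lborel. x * V x) / a\<bar> \<le> 2 * M * K * R^3 / a\<^sup>2"
proof -
  have M: "0 \<le> M" using V(2)[of 0] by linarith
  have K: "0 \<le> K" using order_trans[OF abs_ge_zero h(2)[of R]] R by (simp add: zero_le_mult_iff)
  \<comment> \<open>Extension by zero turns the integral into one over the whole line, where the
    affine substitution applies.\<close>
  define H where "H x = indicator {-R..R} x * h x" for x
  have mH: "H \<in> borel_measurable borel"
    using borel_measurable_continuous_on_indicator[OF _ h(1)] by (simp add: H_def[abs_def])
  have "set_integrable lborel {-R..R} (\<lambda>x. (a * V (a * x)) * h x)"
    by (rule set_integrable_bounded_times_continuous[where M = "a * M"])
      (use V(1,2) a h(1) in \<open>auto simp: abs_mult intro: mult_left_mono\<close>)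
  from set_borel_integral_eq_integral(2)[OF this, symmetric]
  have "integral {-R..R} (\<lambda>x. a * V (a * x) * h x) = (LINT x|lborel. a * (V (a * x) * H x))"
    by (simp add: set_lebesgue_integral_def H_def mult_ac)
  also have "\<dots> = \<bar>a\<bar> *\<^sub>R (LINT x|lborel. V (0 + a * x) * H ((0 + a * x) / a))"
    using a by simp
  also have "\<dots> = (LINT t|lborel. V t * H (t / a))"
    by (rule lborel_integral_real_affine[symmetric, where f = "\<lambda>t. V t * H (t / a)"]) (use a in auto)
  finally have I: "integral {-R..R} (\<lambda>x. a * V (a * x) * h x) = (LINT t|lborel. V t * H (t / a))" .
  have bnd: "integrable lborel g" if "g \<in> borel_measurable borel" "\<And>x. \<bar>g x\<bar> \<le> C" "\<And>x. R \<le> \<bar>x\<bar> \<Longrightarrow> g x = 0" for g :: "real \<Rightarrow> real" and C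
  proof -
    have "integrable lborel (\<lambda>x. indicator {-R..R} x *\<^sub>R C)"
      by (intro integrable_scaleR_left integrable_real_indicator) (auto simp: emeasure_lborel_Icc_eq)
    then show ?thesis
      by (rule Bochner_Integration.integrable_bound)
        (use that in \<open>auto simp: indicator_def intro!: AE_I2 order_trans[OF that(2)]\<close>)
  qed
  have iV: "integrable lborel V" by (rule bnd[OF V])
  have ixV: "integrable lborel (\<lambda>x. x * V x)"
  proof (rule bnd[of _ "R * M"])
    show "\<bar>x * V x\<bar> \<le> R * M" for x
    proof (cases "R \<le> \<bar>x\<bar>")
      case False
      then show ?thesis using V(2)[of x] R unfolding abs_mult by (intro mult_mono) auto
    qed (use V(3) R M in simp)
  qed (use V in auto)
  \<comment> \<open>Off the support both sides are harmless. On it, \<open>a \<ge> 1\<close> keeps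
    \<open>t / a\<close> inside \<open>{-R..R}\<close>, where \<open>H\<close> is \<open>h\<close>
    and the quadratic bound is available.\<close>
  have err: "\<bar>V t * (H (t / a) - h0 - h1 * (t / a))\<bar> \<le> indicator {-R..R} t *\<^sub>R (M * (K * (R / a)\<^sup>2))" for t
  proof (cases "R \<le> \<bar>t\<bar>")
    case True
    then show ?thesis using V(3)[of t] K M by simp
  next
    case False
    have "\<bar>t / a\<bar> \<le> \<bar>t\<bar>" using a mult_left_mono[of 1 a "\<bar>t\<bar>"] by (simp add: field_simps)
    then have ta: "t / a \<in> {-R..R}" using False unfolding atLeastAtMost_iff by linarith
    have "(t / a)\<^sup>2 \<le> (R / a)\<^sup>2" using False a
      by (intro abs_le_square_iff[THEN iffD1]) (auto simp: divide_right_mono)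
    then have "\<bar>H (t / a) - h0 - h1 * (t / a)\<bar> \<le> K * (R / a)\<^sup>2"
      using order_trans[OF h(2)[OF ta] mult_left_mono[OF _ K]] ta by (simp add: H_def)
    then have "\<bar>V t\<bar> * \<bar>H (t / a) - h0 - h1 * (t / a)\<bar> \<le> M * (K * (R / a)\<^sup>2)"
      using V(2)[of t] M by (intro mult_mono) auto
    moreover have "t \<in> {-R..R}" using False by auto
    ultimately show ?thesis by (simp add: abs_mult)
  qed
  have ie: "integrable lborel (\<lambda>t. indicator {-R..R} t *\<^sub>R (M * (K * (R / a)\<^sup>2)))"
    by (intro integrable_scaleR_left integrable_real_indicator) (auto simp: emeasure_lborel_Icc_eq)
  have i3: "integrable lborel (\<lambda>t. V t * (H (t / a) - h0 - h1 * (t / a)))"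
    by (rule Bochner_Integration.integrable_bound[OF ie])
      (use V(1) mH err K M in \<open>auto intro!: AE_I2 order_trans[OF err]\<close>)
  have "(LINT t|lborel. V t * H (t / a)) = (LINT t|lborel. V t * (H (t / a) - h0 - h1 * (t / a)) + (h0 * V t + (h1 / a) * (t * V t)))"
    by (rule Bochner_Integration.integral_cong) (auto simp: algebra_simps)
  also have "\<dots> = (LINT t|lborel. V t * (H (t / a) - h0 - h1 * (t / a))) + (h0 * (LINT t|lborel. V t) + (h1 / a) * (LINT t|lborel. t * V t))"
    using i3 iV ixV by simp
  finally have "integral {-R..R} (\<lambda>x. a * V (a * x) * h x) - h1 * (LINT x|lborel. x * V x) / a
     = (LINT t|lborel. V t * (H (t / a) - h0 - h1 * (t / a)))" using I V0 by simp
  also have "\<bar>\<dots>\<bar> \<le> (LINT t|lborel. indicator {-R..R} t *\<^sub>R (M * (K * (R / a)\<^sup>2)))"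
    using Bochner_Integration.integral_norm_bound_integral[OF i3 ie] err by simp
  also have "\<dots> = 2 * M * K * R^3 / a\<^sup>2"
    using R by (simp add: power2_eq_square power3_eq_cube field_simps)
  finally show ?thesis .
qed

text \<open>The slope \<open>p\<close> is Lipschitz with constant \<open>Q * B\<close>, being an
  integral of \<open>q * f\<close>; integrating \<open>p - p x\<close> gives the quadratic
  remainder. No pointwise second derivative enters.\<close>

lemma schr_sol_taylor:
  assumes s: "schr_sol q {a..b} f p" and q: "\<And>x. \<bar>q x\<bar> \<le> Q" and f: "\<And>x. x \<in> {a..b} \<Longrightarrow> \<bar>f x\<bar> \<le> B"
    and xy: "x \<in> {a..b}" "y \<in> {a..b}"
  shows "\<bar>f y - f x - p x * (y - x)\<bar> \<le> Q * B * (y - x)\<^sup>2"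
proof -
  have Q: "0 \<le> Q" using q[of 0] by linarith
  have B: "0 \<le> B" using f[OF xy(1)] by linarith
  have lip: "\<bar>p v - p u\<bar> \<le> Q * B * (v - u)" if "u \<le> v" "{u..v} \<subseteq> {a..b}" for u v
  proof -
    have "\<bar>q t * f t\<bar> \<le> Q * B" if "t \<in> {a..b}" for t
      using mult_mono[OF q[of t] f[OF that] Q] by (simp add: abs_mult)
    then show ?thesis
      using has_integral_bound_real[OF _ finite.emptyI schr_solD(2)[OF s that], of "Q * B"] that Q B by auto
  qed
  \<comment> \<open>Allowing the slope from either endpoint covers expansion points to the left and
    to the right of the evaluation point.\<close>
  have main: "\<bar>f v - f u - c * (v - u)\<bar> \<le> Q * B * (v - u)\<^sup>2" if uv: "u \<le> v" "{u..v} \<subseteq> {a..b}" and c: "c = p u \<or> c = p v" for u v c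
  proof -
    have "\<bar>p t - c\<bar> \<le> Q * B * (v - u)" if t: "t \<in> {u..v}" for t
    proof -
      have "\<bar>p t - p u\<bar> \<le> Q * B * (t - u)" "\<bar>p v - p t\<bar> \<le> Q * B * (v - t)"
        using t uv by (auto intro!: lip)
      moreover have "Q * B * (t - u) \<le> Q * B * (v - u)" "Q * B * (v - t) \<le> Q * B * (v - u)"
        using t Q B by (auto intro!: mult_left_mono)
      ultimately show ?thesis using c by (auto simp: abs_minus_commute)
    qed
    note bd = this
    have hi: "((\<lambda>t. p t - c) has_integral (f v - f u - (v - u) * c)) {u..v}"
      using has_integral_diff[OF schr_solD(1)[OF s uv] has_integral_const_real[of c u v]] uv by simp
    have "\<bar>f v - f u - (v - u) * c\<bar> \<le> Q * B * (v - u) * (v - u)"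
      using has_integral_bound_real[OF _ finite.emptyI hi, of "Q * B * (v - u)"] bd uv Q B by simp
    then show ?thesis by (simp add: power2_eq_square mult_ac)
  qed
  show ?thesis
  proof (cases "x \<le> y")
    case True
    then show ?thesis using xy by (intro main) auto
  next
    case False
    then have "\<bar>f x - f y - p x * (x - y)\<bar> \<le> Q * B * (x - y)\<^sup>2" using xy by (intro main) auto
    moreover have "f y - f x - p x * (y - x) = - (f x - f y - p x * (x - y))" by (simp add: algebra_simps)
    ultimately show ?thesis by (simp only: abs_minus_cancel power2_commute)
  qed
qed

section \<open>The matching function \<open>F\<close>, its asymptotics and its zeros\<close>

locale half_bound_dipole =
  fixes U V u u' :: "real \<Rightarrow> real" and R M \<theta> :: real
  assumes U: "U \<in> borel_measurable borel" "\<bar>U x\<bar> \<le> M" "R \<le> \<bar>x\<bar> \<Longrightarrow> U x = 0"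
    and V: "V \<in> borel_measurable borel" "\<bar>V x\<bar> \<le> M" "R \<le> \<bar>x\<bar> \<Longrightarrow> V x = 0"
    and R: "R > 0" and sol_u: "schr_sol U {-R..R} u u'"
    and u_left: "u (-R) = 1" "u' (-R) = 0" and u_right: "u R = \<theta>" "u' R = 0"
    and V_mean: "(LINT x|lborel. V x) = 0"
begin

definition m where "m = (LINT x|lborel. x * V x)"

text \<open>The coefficient in \<open>f'' = q f\<close> for the perturbed operator at energy
  \<open>- k^2\<close>.\<close>

definition q where "q l a k x = U x + l * a * V (a * x) + k\<^sup>2" for l a k x :: real

lemma M_nonneg: "0 \<le> M" using U(2)[of 0] by linarith

lemma q_measurable: "q l a k \<in> borel_measurable borel"
  unfolding q_def[abs_def] using U(1) V(1) by measurable

lemma q_bound: "\<bar>q l a k x\<bar> \<le> M + \<bar>l * a\<bar> * M + k\<^sup>2"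
proof -
  have "\<bar>l * a * V (a * x)\<bar> \<le> \<bar>l * a\<bar> * M" using V(2)[of "a * x"] by (simp add: abs_mult mult_left_mono)
  then show ?thesis using U(2)[of x] unfolding q_def by (smt (verit) zero_le_power2)
qed

text \<open>The Jost solution \<open>e\<^bsup>k (x + R)\<^esup>\<close>, continued from the left of the supports to \<open>[-R, R]\<close>; a zero of
  \<open>F\<close> below says that it continues as a decaying exponential on the right.\<close>

definition jost where
  "jost l a k = (SOME fp. schr_sol (q l a k) {-R..R} (fst fp) (snd fp) \<and> fst fp (-R) = 1 \<and> snd fp (-R) = k)"

definition f where "f l a k = fst (jost l a k)"
definition p where "p l a k = snd (jost l a k)"

lemma jost: "schr_sol (q l a k) {-R..R} (f l a k) (p l a k)" "f l a k (-R) = 1" "p l a k (-R) = k"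
proof -
  obtain g r where "schr_sol (q l a k) {-R..R} g r" "g (-R) = 1" "r (-R) = k"
    using schr_sol_exists[OF q_measurable q_bound, of "-R" R l a k 1 k] R by auto
  then have "\<exists>fp. schr_sol (q l a k) {-R..R} (fst fp) (snd fp) \<and> fst fp (-R) = 1 \<and> snd fp (-R) = k"
    by (intro exI[of _ "(g, r)"]) simp
  from someI_ex[OF this, folded jost_def]
  show "schr_sol (q l a k) {-R..R} (f l a k) (p l a k)" "f l a k (-R) = 1" "p l a k (-R) = k"
    by (auto simp: f_def p_def)
qed

definition F where "F l a k = p l a k R + k * f l a k R"

text \<open>If \<open>\<theta> = 0\<close>, the conserved Wronskian with the solution starting from data \<open>(0, 1)\<close> would be both 1 and 0.\<close>

lemma theta_nonzero: "\<theta> \<noteq> 0"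
proof
  assume "\<theta> = 0"
  obtain g r where g: "schr_sol U {-R..R} g r" "g (-R) = 0" "r (-R) = 1"
    using schr_sol_exists[OF U(1,2), of "-R" R 0 1] R by auto
  have "((\<lambda>t. (U t - U t) * (u t * g t)) has_integral (u R * r R - u' R * g R - (u (-R) * r (-R) - u' (-R) * g (-R)))) {-R..R}"
    using R by (intro schr_sol_wronskian[OF sol_u g(1) U(1,2) U(1,2)]) auto
  then have "((\<lambda>t. 0::real) has_integral -1) {-R..R}" using \<open>\<theta> = 0\<close> g u_left u_right by simp
  from has_integral_unique[OF this has_integral_0] show False by simp
qed

text \<open>As \<open>u'\<close> vanishes at both ends, the Wronskian of \<open>u\<close> and the
  Jost solution is \<open>\<theta> * p l a k R\<close> at \<open>R\<close> and \<open>k\<close> at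
  \<open>-R\<close>; adding \<open>k * \<theta> * f l a k R\<close> completes
  \<open>\<theta> * F l a k\<close>. The factor \<open>a\<close> stays inside the first integral,
  the form to which the dipole estimate applies.\<close>

lemma wronskian_identity:
  "\<theta> * F l a k = k + k * \<theta> * f l a k R
     + l * integral {-R..R} (\<lambda>x. a * V (a * x) * (u x * f l a k x))
     + k\<^sup>2 * integral {-R..R} (\<lambda>x. u x * f l a k x)"
proof -
  note c = schr_sol_continuous[OF sol_u] schr_sol_continuous[OF jost(1)[of l a k]]
  let ?K = "M + \<bar>l * a\<bar> * M + k\<^sup>2"
  have UK: "\<bar>U x\<bar> \<le> ?K" for x using U(2)[of x] M_nonneg by (smt (verit) abs_ge_zero mult_nonneg_nonneg zero_le_power2)
  have 1: "((\<lambda>t. (q l a k t - U t) * (u t * f l a k t)) has_integral (\<theta> * p l a k R - k)) {-R..R}"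
    using schr_sol_wronskian[OF sol_u jost(1) U(1) UK q_measurable q_bound] R u_left u_right jost(2,3)[of l a k] by simp
  have i1: "(\<lambda>x. a * V (a * x) * (u x * f l a k x)) integrable_on {-R..R}"
  proof (rule integrable_on_bounded_times_continuous[where M = "\<bar>a\<bar> * M"])
    show "(\<lambda>x. a * V (a * x)) \<in> borel_measurable borel" using V(1) by measurable
    show "\<bar>a * V (a * x)\<bar> \<le> \<bar>a\<bar> * M" for x using V(2) by (simp add: abs_mult mult_left_mono)
    show "continuous_on {-R..R} (\<lambda>x. u x * f l a k x)" by (intro continuous_intros c)
  qed
  have i2: "(\<lambda>x. u x * f l a k x) integrable_on {-R..R}"
    by (intro integrable_continuous_real continuous_intros c)
  have "((\<lambda>t. l * (a * V (a * t) * (u t * f l a k t)) + k\<^sup>2 * (u t * f l a k t)) has_integral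
     (l * integral {-R..R} (\<lambda>x. a * V (a * x) * (u x * f l a k x)) + k\<^sup>2 * integral {-R..R} (\<lambda>x. u x * f l a k x))) {-R..R}"
    by (intro has_integral_add has_integral_mult_right integrable_integral i1 i2)
  moreover have "(\<lambda>t. l * (a * V (a * t) * (u t * f l a k t)) + k\<^sup>2 * (u t * f l a k t)) = (\<lambda>t. (q l a k t - U t) * (u t * f l a k t))"
    by (rule ext) (simp add: q_def algebra_simps)
  ultimately have "\<theta> * p l a k R - k = l * integral {-R..R} (\<lambda>x. a * V (a * x) * (u x * f l a k x)) + k\<^sup>2 * integral {-R..R} (\<lambda>x. u x * f l a k x)"
    using has_integral_unique[OF 1] by simp
  then show ?thesis by (simp add: F_def algebra_simps)
qed

text \<open>Needed for the intermediate value theorem. The solution at \<open>k0\<close> is compared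
  with the one at \<open>k\<close>; the resulting bound is continuous in \<open>k\<close> and
  vanishes at \<open>k0\<close>.\<close>

lemma F_continuous: "continuous_on UNIV (F l a)"
proof -
  have "((\<lambda>k. \<bar>f l a k0 R - f l a k R\<bar> + \<bar>p l a k0 R - p l a k R\<bar>) \<longlongrightarrow> 0) (at k0)" for k0
  proof -
    obtain B where B: "\<And>x. x \<in> {-R..R} \<Longrightarrow> \<bar>f l a k0 x\<bar> \<le> B"
      using continuous_on_Icc_bounded[OF schr_sol_continuous(1)[OF jost(1)[of l a k0]]] by blast
    have le: "\<bar>f l a k0 R - f l a k R\<bar> + \<bar>p l a k0 R - p l a k R\<bar> \<le>
      (\<bar>k0 - k\<bar> + \<bar>k0\<^sup>2 - k\<^sup>2\<bar> * B * (R - -R)) * exp ((1 + (M + \<bar>l * a\<bar> * M + k\<^sup>2)) * (R - -R))" for k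
      using schr_sol_compare[OF jost(1)[of l a k0] jost(1)[of l a k] q_bound _ B, of "\<bar>k0\<^sup>2 - k\<^sup>2\<bar>" R] R
      by (simp add: jost(2,3) q_def)
    show ?thesis
    proof (rule Lim_null_comparison)
      show "\<forall>\<^sub>F k in at k0. norm (\<bar>f l a k0 R - f l a k R\<bar> + \<bar>p l a k0 R - p l a k R\<bar>) \<le>
         (\<bar>k0 - k\<bar> + \<bar>k0\<^sup>2 - k\<^sup>2\<bar> * B * (R - -R)) * exp ((1 + (M + \<bar>l * a\<bar> * M + k\<^sup>2)) * (R - -R))"
        using le by (intro always_eventually) simp
      have "((\<lambda>k. (\<bar>k0 - k\<bar> + \<bar>k0\<^sup>2 - k\<^sup>2\<bar> * B * (R - -R)) * exp ((1 + (M + \<bar>l * a\<bar> * M + k\<^sup>2)) * (R - -R)))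
        \<longlongrightarrow> (\<bar>k0 - k0\<bar> + \<bar>k0\<^sup>2 - k0\<^sup>2\<bar> * B * (R - -R)) * exp ((1 + (M + \<bar>l * a\<bar> * M + k0\<^sup>2)) * (R - -R))) (at k0)"
        by (intro tendsto_intros)
      then show "((\<lambda>k. (\<bar>k0 - k\<bar> + \<bar>k0\<^sup>2 - k\<^sup>2\<bar> * B * (R - -R)) * exp ((1 + (M + \<bar>l * a\<bar> * M + k\<^sup>2)) * (R - -R))) \<longlongrightarrow> 0) (at k0)"
        by simp
    qed
  qed
  note lim = this
  have "isCont (\<lambda>k. f l a k R) k0" "isCont (\<lambda>k. p l a k R) k0" for k0
  proof -
    have "((\<lambda>k. f l a k R - f l a k0 R) \<longlongrightarrow> 0) (at k0)" "((\<lambda>k. p l a k R - p l a k0 R) \<longlongrightarrow> 0) (at k0)"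
      by (rule Lim_null_comparison[OF _ lim], intro always_eventually allI, simp)+
    then show "isCont (\<lambda>k. f l a k R) k0" "isCont (\<lambda>k. p l a k R) k0"
      unfolding isCont_def by (simp_all add: LIM_zero_iff)
  qed
  then show ?thesis
    unfolding F_def[abs_def] by (intro continuous_at_imp_continuous_on ballI continuous_intros)
qed

text \<open>The constant is uniform in \<open>l\<close>, \<open>a\<close> and \<open>s\<close>. The
  error \<open>l * a\<close> comes from the distance between the Jost solution and \<open>u\<close>
  and from the \<open>k^2\<close> integral (via \<open>l / a \<le> l * a\<close>); the error
  \<open>1 / a\<close> is the dipole remainder.\<close>

lemma F_asymptotics:
  assumes S: "S \<ge> 0"
  obtains C where "\<And>l a s. 0 < l \<Longrightarrow> 1 \<le> a \<Longrightarrow> l * a \<le> 1 \<Longrightarrow> 0 \<le> s \<Longrightarrow> s \<le> S \<Longrightarrow>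
     \<bar>a / l * (\<theta> * F l a (s * l / a)) - (s * (1 + \<theta>\<^sup>2) + 2 * u 0 * u' 0 * m)\<bar> \<le> C * (l * a + 1 / a)"
proof -
  from schr_sol_continuous[OF sol_u, THEN continuous_on_Icc_bounded] obtain Ba Bb where
    Bab: "\<And>x. x \<in> {-R..R} \<Longrightarrow> \<bar>u x\<bar> \<le> Ba" "\<And>x. x \<in> {-R..R} \<Longrightarrow> \<bar>u' x\<bar> \<le> Bb" by metis
  define B where "B = max Ba Bb"
  have B: "\<bar>u x\<bar> \<le> B" "\<bar>u' x\<bar> \<le> B" if "x \<in> {-R..R}" for x
    using Bab[OF that] by (auto simp: B_def)
  have B0: "0 \<le> B" using B(1)[of 0] R by auto
  define Q where "Q = 2 * M + S\<^sup>2"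
  \<comment> \<open>The comparison bound with \<open>l * a\<close> factored out, using
    \<open>k \<le> S * (l * a)\<close> and \<open>k^2 \<le> S^2 * (l * a)\<close>.\<close>
  define C0 where "C0 = (S + (M + S\<^sup>2) * B * (R - -R)) * exp ((1 + Q) * (R - -R))"
  \<comment> \<open>A common bound for \<open>u\<close>, the Jost solution and both slopes, valid
    since \<open>l * a \<le> 1\<close>.\<close>
  define B1 where "B1 = B + C0"
  \<comment> \<open>Collects the quadratic terms in the product of the two Taylor expansions at
    0.\<close>
  define K where "K = B1\<^sup>2 * (1 + 2 * Q + R * Q)"
  \<comment> \<open>In order: replacing \<open>f\<close> by \<theta> at \<open>R\<close>, replacing
    the slope of the product by its limit, the \<open>k^2\<close> integral, and the dipole
    remainder.\<close>
  define C where "C = S * \<bar>\<theta>\<bar> * C0 + B * C0 * \<bar>m\<bar> + S\<^sup>2 * (B1 * B1 * (2 * R)) + 2 * M * K * R^3"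
  note M = M_nonneg
  have Q0: "0 \<le> Q" using M by (simp add: Q_def)
  have C00: "0 \<le> C0" unfolding C0_def using S M B0 R by (intro mult_nonneg_nonneg add_nonneg_nonneg) auto
  show ?thesis
  proof (rule that)
    fix l a s :: real assume l: "0 < l" and a: "1 \<le> a" and la: "l * a \<le> 1" and s: "0 \<le> s" "s \<le> S"
    define k where "k = s * l / a"
    let ?f = "f l a k" and ?p = "p l a k"
    have la0: "0 < l * a" using l a by simp
    have loa: "l / a \<le> l * a"
    proof -
      have "l / a \<le> l" "l \<le> l * a" using l a by (auto simp: field_simps)
      then show ?thesis by simp
    qed
    have k0: "0 \<le> k" using s l a by (simp add: k_def)
    have k1: "k \<le> S * (l * a)"
      unfolding k_def using s loa l a by (simp flip: times_divide_eq_right) (intro mult_mono, auto)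
    have "k \<le> S" using k1 mult_left_mono[OF la S] by simp
    then have "k\<^sup>2 \<le> S * (S * (l * a))" unfolding power2_eq_square using k0 k1 S by (intro mult_mono) auto
    then have k2: "k\<^sup>2 \<le> S\<^sup>2 * (l * a)" by (simp add: power2_eq_square mult.assoc)
    have k2S: "k\<^sup>2 \<le> S\<^sup>2" using \<open>k \<le> S\<close> k0 by (simp add: power_mono)
    have qQ: "\<bar>q l a k x\<bar> \<le> Q" for x
    proof -
      have "\<bar>l * a\<bar> * M \<le> 1 * M" using la la0 M by (intro mult_right_mono) auto
      then show ?thesis using q_bound[of l a k x] k2S by (simp add: Q_def)
    qed
    have UQ: "\<bar>U x\<bar> \<le> Q" for x using U(2)[of x] M unfolding Q_def by (smt (verit) zero_le_power2)
    have close: "\<bar>u x - ?f x\<bar> + \<bar>u' x - ?p x\<bar> \<le> C0 * (l * a)" if x: "x \<in> {-R..R}" for x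
    proof -
      have dq: "\<bar>U x - q l a k x\<bar> \<le> l * a * M + k\<^sup>2" for x
      proof -
        have "\<bar>l * a * V (a * x)\<bar> \<le> l * a * M"
          using mult_left_mono[OF V(2)[of "a * x"], of "l * a"] l a by (simp add: abs_mult)
        then show ?thesis using zero_le_power2[of k] unfolding q_def by linarith
      qed
      have "\<bar>u x - ?f x\<bar> + \<bar>u' x - ?p x\<bar> \<le> (\<bar>u (-R) - ?f (-R)\<bar> + \<bar>u' (-R) - ?p (-R)\<bar> + (l * a * M + k\<^sup>2) * B * (R - -R)) * exp ((1 + Q) * (R - -R))"
        by (rule schr_sol_compare[OF sol_u jost(1) qQ dq B(1) x])
      also have "\<dots> = (k + (l * a * M + k\<^sup>2) * B * (R - -R)) * exp ((1 + Q) * (R - -R))"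
        using u_left jost(2,3)[of l a k] k0 by simp
      also have "\<dots> \<le> (S * (l * a) + (l * a * M + S\<^sup>2 * (l * a)) * B * (R - -R)) * exp ((1 + Q) * (R - -R))"
        using k1 k2 B0 R by (intro mult_right_mono add_mono order_refl) auto
      also have "\<dots> = C0 * (l * a)" by (simp add: C0_def algebra_simps)
      finally show ?thesis .
    qed
    have "C0 * (l * a) \<le> C0" using mult_left_mono[OF la C00] by simp
    then have fb: "\<bar>?f x\<bar> \<le> B1" and pb: "\<bar>?p x\<bar> \<le> B1" and ub: "\<bar>u x\<bar> \<le> B1" and ub': "\<bar>u' x\<bar> \<le> B1" if "x \<in> {-R..R}" for x
      using close[OF that] B[OF that] C00 unfolding B1_def by linarith+
    have B10: "0 \<le> B1" using B0 C00 by (simp add: B1_def)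
    have z: "0 \<in> {-R..R}" using R by auto
    \<comment> \<open>The slope at 0 of the product of \<open>u\<close> and the Jost solution.
      Closeness of the latter to \<open>u\<close> in values and slopes makes it close to
      \<open>2 * u 0 * u' 0\<close>.\<close>
    let ?h1 = "u' 0 * ?f 0 + u 0 * ?p 0"
    have tay: "\<bar>u x * ?f x - u 0 * ?f 0 - ?h1 * x\<bar> \<le> K * x\<^sup>2" if x: "x \<in> {-R..R}" for x
    proof -
      define e1 where "e1 = ?f x - ?f 0 - ?p 0 * x"
      define e2 where "e2 = u x - u 0 - u' 0 * x"
      have e1: "\<bar>e1\<bar> \<le> Q * B1 * x\<^sup>2" using schr_sol_taylor[OF jost(1) qQ fb z x] by (simp add: e1_def)
      have e2: "\<bar>e2\<bar> \<le> Q * B1 * x\<^sup>2" using schr_sol_taylor[OF sol_u UQ ub z x] by (simp add: e2_def)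
      have "u x * ?f x - u 0 * ?f 0 - ?h1 * x = u' 0 * ?p 0 * x\<^sup>2 + (?f 0 + ?p 0 * x) * e2 + u x * e1"
        by (simp add: e1_def e2_def algebra_simps power2_eq_square)
      also have "\<bar>\<dots>\<bar> \<le> \<bar>u' 0 * ?p 0 * x\<^sup>2\<bar> + \<bar>(?f 0 + ?p 0 * x) * e2\<bar> + \<bar>u x * e1\<bar>" by linarith
      also have "\<dots> \<le> B1 * B1 * x\<^sup>2 + (B1 + B1 * R) * (Q * B1 * x\<^sup>2) + B1 * (Q * B1 * x\<^sup>2)"
      proof (intro add_mono)
        show "\<bar>u' 0 * ?p 0 * x\<^sup>2\<bar> \<le> B1 * B1 * x\<^sup>2"
          unfolding abs_mult using ub'[OF z] pb[OF z] B10 by (intro mult_mono) auto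
        have "\<bar>?p 0 * x\<bar> \<le> B1 * R" unfolding abs_mult using pb[OF z] x B10 by (intro mult_mono) auto
        then have "\<bar>?f 0 + ?p 0 * x\<bar> \<le> B1 + B1 * R" using fb[OF z] by linarith
        then show "\<bar>(?f 0 + ?p 0 * x) * e2\<bar> \<le> (B1 + B1 * R) * (Q * B1 * x\<^sup>2)"
          unfolding abs_mult using e2 B10 R by (intro mult_mono) auto
        show "\<bar>u x * e1\<bar> \<le> B1 * (Q * B1 * x\<^sup>2)"
          unfolding abs_mult using e1 ub[OF x] B10 by (intro mult_mono) auto
      qed
      also have "\<dots> = K * x\<^sup>2" by (simp add: K_def algebra_simps power2_eq_square)
      finally show ?thesis .
    qed
    note cont = schr_sol_continuous[OF sol_u] schr_sol_continuous[OF jost(1)[of l a k]]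
    let ?I = "integral {-R..R} (\<lambda>x. a * V (a * x) * (u x * ?f x))"
    let ?J = "integral {-R..R} (\<lambda>x. u x * ?f x)"
    have I: "\<bar>?I - ?h1 * m / a\<bar> \<le> 2 * M * K * R^3 / a\<^sup>2"
      unfolding m_def using tay by (intro dipole_integral_estimate V V_mean a R continuous_intros cont)
    have "\<bar>a * ?I - ?h1 * m\<bar> = a * \<bar>?I - ?h1 * m / a\<bar>" using a by (simp add: field_simps flip: abs_mult_pos')
    also have "\<dots> \<le> a * (2 * M * K * R^3 / a\<^sup>2)" using I a by (intro mult_left_mono) auto
    also have "\<dots> = 2 * M * K * R^3 * (1 / a)" using a by (simp add: power2_eq_square)
    finally have I': "\<bar>a * ?I - ?h1 * m\<bar> \<le> 2 * M * K * R^3 * (1 / a)" .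
    have J: "\<bar>?J\<bar> \<le> B1 * B1 * (2 * R)"
    proof -
      have "(\<lambda>x. u x * ?f x) integrable_on {-R..R}"
        by (intro integrable_continuous_real continuous_intros cont)
      moreover have "\<bar>u x * ?f x\<bar> \<le> B1 * B1" if "x \<in> {-R..R}" for x
        unfolding abs_mult using ub[OF that] fb[OF that] B10 by (intro mult_mono) auto
      ultimately show ?thesis
        using has_integral_bound_real[OF _ finite.emptyI integrable_integral, of "B1 * B1" "\<lambda>x. u x * ?f x" "-R" R] R by simp
    qed
    have t1: "\<bar>s * \<theta> * (?f R - \<theta>)\<bar> \<le> S * \<bar>\<theta>\<bar> * (C0 * (l * a))"
      unfolding abs_mult using close[of R] u_right R s C00 la0 by (intro mult_mono) auto
    have t2: "\<bar>(?h1 - 2 * u 0 * u' 0) * m\<bar> \<le> B * (C0 * (l * a)) * \<bar>m\<bar>"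
    proof -
      have "\<bar>?h1 - 2 * u 0 * u' 0\<bar> = \<bar>u' 0 * (?f 0 - u 0) + u 0 * (?p 0 - u' 0)\<bar>" by (simp add: algebra_simps)
      also have "\<dots> \<le> \<bar>u' 0\<bar> * \<bar>?f 0 - u 0\<bar> + \<bar>u 0\<bar> * \<bar>?p 0 - u' 0\<bar>"
        unfolding abs_mult[symmetric] by (rule abs_triangle_ineq)
      also have "\<dots> \<le> B * \<bar>?f 0 - u 0\<bar> + B * \<bar>?p 0 - u' 0\<bar>"
        using B[OF z] by (intro add_mono mult_right_mono) auto
      also have "\<dots> = B * (\<bar>u 0 - ?f 0\<bar> + \<bar>u' 0 - ?p 0\<bar>)" by (simp add: algebra_simps abs_minus_commute)
      also have "\<dots> \<le> B * (C0 * (l * a))" using close[OF z] B0 by (intro mult_left_mono) auto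
      finally show ?thesis unfolding abs_mult by (intro mult_right_mono) auto
    qed
    have t3: "\<bar>s\<^sup>2 * (l / a) * ?J\<bar> \<le> S\<^sup>2 * (l * a) * (B1 * B1 * (2 * R))"
      unfolding abs_mult using s loa J l a B10 R S by (intro mult_mono power_mono) (auto simp: power_mono)
    \<comment> \<open>With \<open>k = s * l / a\<close>, the normalization by \<open>a / l\<close>
      turns \<open>k\<close> into \<open>s\<close> and \<open>k^2\<close> into
      \<open>s^2 * (l / a)\<close>.\<close>
    have "a / l * (\<theta> * F l a k) = s + s * \<theta> * ?f R + a * ?I + s\<^sup>2 * (l / a) * ?J"
      unfolding wronskian_identity[of l a k] using l a by (simp add: k_def field_simps power2_eq_square)
    then have D: "a / l * (\<theta> * F l a k) - (s * (1 + \<theta>\<^sup>2) + 2 * u 0 * u' 0 * m)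
      = s * \<theta> * (?f R - \<theta>) + (?h1 - 2 * u 0 * u' 0) * m + s\<^sup>2 * (l / a) * ?J + (a * ?I - ?h1 * m)"
      by (simp add: algebra_simps power2_eq_square)
    have "\<bar>a / l * (\<theta> * F l a k) - (s * (1 + \<theta>\<^sup>2) + 2 * u 0 * u' 0 * m)\<bar>
      \<le> S * \<bar>\<theta>\<bar> * (C0 * (l * a)) + B * (C0 * (l * a)) * \<bar>m\<bar> + S\<^sup>2 * (l * a) * (B1 * B1 * (2 * R)) + 2 * M * K * R^3 * (1 / a)"
      unfolding D using t1 t2 t3 I' by linarith
    also have "\<dots> = (S * \<bar>\<theta>\<bar> * C0 + B * C0 * \<bar>m\<bar> + S\<^sup>2 * (B1 * B1 * (2 * R))) * (l * a) + (2 * M * K * R^3) * (1 / a)"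
    proof -
      have "S * \<bar>\<theta>\<bar> * (C0 * L) + B * (C0 * L) * \<bar>m\<bar> + S\<^sup>2 * L * T = (S * \<bar>\<theta>\<bar> * C0 + B * C0 * \<bar>m\<bar> + S\<^sup>2 * T) * L" for L T
        by (simp add: algebra_simps)
      then show ?thesis by presburger
    qed
    also have "\<dots> \<le> C * (l * a) + C * (1 / a)"
    proof (intro add_mono mult_right_mono)
      have "0 \<le> K" using Q0 R by (auto simp: K_def intro!: mult_nonneg_nonneg add_nonneg_nonneg)
      then have "0 \<le> 2 * M * K * R^3" using M R by auto
      then show "S * \<bar>\<theta>\<bar> * C0 + B * C0 * \<bar>m\<bar> + S\<^sup>2 * (B1 * B1 * (2 * R)) \<le> C" by (simp add: C_def)
      have "0 \<le> S * \<bar>\<theta>\<bar> * C0" "0 \<le> B * C0 * \<bar>m\<bar>" "0 \<le> S\<^sup>2 * (B1 * B1 * (2 * R))"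
        using S C00 B0 R by auto
      then show "2 * M * K * R^3 \<le> C" by (simp add: C_def)
    qed (use l a in auto)
    finally show "\<bar>a / l * (\<theta> * F l a (s * l / a)) - (s * (1 + \<theta>\<^sup>2) + 2 * u 0 * u' 0 * m)\<bar> \<le> C * (l * a + 1 / a)"
      by (simp add: k_def distrib_left)
  qed
qed

text \<open>Since \<open>a \<ge> 1\<close>, the scaled potential also vanishes for
  \<open>R \<le> \<bar>x\<bar>\<close>, so \<open>F = 0\<close> is the matching condition.
  Almost-everywhere equality for \<open>W\<close> allows the return to the original
  potentials.\<close>

lemma F_zero_imp_eigenvalue:
  assumes "F l a k = 0" "k > 0" "a \<ge> 1"
    and W: "AE x in lborel. W x = U x + l * a * V (a * x)"
  shows "schr_eigenvalue W (- k\<^sup>2)"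
proof (rule schr_eigenvalue_of_matching[OF jost(1) q_measurable q_bound _ \<open>k > 0\<close> R jost(2,3)])
  show "q l a k x = k\<^sup>2" if "R \<le> \<bar>x\<bar>" for x
  proof -
    have "1 * \<bar>x\<bar> \<le> a * \<bar>x\<bar>" using \<open>a \<ge> 1\<close> by (intro mult_right_mono) auto
    then have "R \<le> \<bar>a * x\<bar>" using that \<open>a \<ge> 1\<close> by (simp add: abs_mult)
    then show ?thesis using U(3)[OF that] V(3) by (simp add: q_def)
  qed
  show "p l a k R = - k * f l a k R" using assms(1) by (simp add: F_def)
  show "AE x in lborel. q l a k x = W x + k\<^sup>2" using W by eventually_elim (simp add: q_def)
qed

text \<open>The limiting affine function is \<open>(s - c) * (1 + \<theta>^2)\<close>, with opposite
  signs at the ends of \<open>{0..2 * c}\<close>; the sign hypothesis is what makes \<open>c\<close>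
  positive. An error below \<open>c * (1 + \<theta>^2)\<close> preserves these signs, so a zero
  exists, and evaluating the estimate at that zero bounds its distance from
  \<open>c\<close>.\<close>

lemma eigenvalue_near_prediction:
  assumes neg: "u 0 * u' 0 * m < 0"
  defines "c \<equiv> - (2 * u 0 * u' 0 / (\<theta>\<^sup>2 + 1) * m)"
  obtains C where "\<And>l a. 0 < l \<Longrightarrow> 1 \<le> a \<Longrightarrow> l * a \<le> 1 \<Longrightarrow> C * (l * a + 1 / a) < c \<Longrightarrow>
     \<exists>s>0. \<bar>s - c\<bar> \<le> C * (l * a + 1 / a) \<and> (\<forall>W. (AE x in lborel. W x = U x + l * a * V (a * x)) \<longrightarrow> schr_eigenvalue W (- (s * l / a)\<^sup>2))"
proof -
  have t: "1 + \<theta>\<^sup>2 > 0" by (simp add: add_pos_nonneg)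
  have c: "c > 0"
  proof -
    have "c = - 2 * (u 0 * u' 0 * m) / (1 + \<theta>\<^sup>2)" by (simp add: c_def add.commute)
    moreover have "2 * (u 0 * u' 0 * m) / (1 + \<theta>\<^sup>2) < 0" using neg t by (intro divide_neg_pos) linarith+
    ultimately show ?thesis by simp
  qed
  have ct: "2 * u 0 * u' 0 * m = - c * (1 + \<theta>\<^sup>2)" using t by (simp add: c_def add.commute)
  have "0 \<le> 2 * c" using c by simp
  from F_asymptotics[OF this] obtain C where C: "\<And>l a s. 0 < l \<Longrightarrow> 1 \<le> a \<Longrightarrow> l * a \<le> 1 \<Longrightarrow> 0 \<le> s \<Longrightarrow> s \<le> 2 * c \<Longrightarrow>
     \<bar>a / l * (\<theta> * F l a (s * l / a)) - (s * (1 + \<theta>\<^sup>2) + 2 * u 0 * u' 0 * m)\<bar> \<le> C * (l * a + 1 / a)" by blast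
  show ?thesis
  proof (rule that[of "C / (1 + \<theta>\<^sup>2)"])
    fix l a :: real assume l: "0 < l" and a: "1 \<le> a" and la: "l * a \<le> 1" and small: "C / (1 + \<theta>\<^sup>2) * (l * a + 1 / a) < c"
    define G where "G s = a / l * (\<theta> * F l a (s * l / a))" for s
    define \<eta> where "\<eta> = C * (l * a + 1 / a)"
    have \<eta>: "\<eta> < c * (1 + \<theta>\<^sup>2)" using small t by (simp add: \<eta>_def field_simps)
    have G: "\<bar>G s - (s - c) * (1 + \<theta>\<^sup>2)\<bar> \<le> \<eta>" if "0 \<le> s" "s \<le> 2 * c" for s
      using C[OF l a la that] unfolding ct G_def \<eta>_def by (simp add: algebra_simps)
    have "continuous_on {0..2 * c} G"
      unfolding G_def using a by (intro continuous_intros continuous_on_compose2[OF F_continuous]) auto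
    moreover have "G 0 \<le> 0" using G[of 0] c \<eta> by (simp add: algebra_simps)
    moreover have "0 \<le> G (2 * c)" using G[of "2 * c"] c \<eta> by (simp add: algebra_simps)
    ultimately obtain s where s: "0 \<le> s" "s \<le> 2 * c" "G s = 0"
      using IVT'[of G 0 0 "2 * c"] c by auto
    have "\<bar>s - c\<bar> * (1 + \<theta>\<^sup>2) \<le> \<eta>" using G[OF s(1,2)] s(3) t by (simp add: abs_mult)
    then have near: "\<bar>s - c\<bar> \<le> C / (1 + \<theta>\<^sup>2) * (l * a + 1 / a)"
      using t by (simp add: \<eta>_def pos_le_divide_eq)
    \<comment> \<open>The error is strictly below \<open>c\<close>, which excludes the zero
      \<open>s = 0\<close>, where no bound state would result.\<close>
    then have sp: "s > 0" using small by linarith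
    have "F l a (s * l / a) = 0" using s(3) l a theta_nonzero by (simp add: G_def)
    then have "\<forall>W. (AE x in lborel. W x = U x + l * a * V (a * x)) \<longrightarrow> schr_eigenvalue W (- (s * l / a)\<^sup>2)"
      using F_zero_imp_eigenvalue[of l a "s * l / a"] a l sp by simp
    with near sp show "\<exists>s>0. \<bar>s - c\<bar> \<le> C / (1 + \<theta>\<^sup>2) * (l * a + 1 / a) \<and> (\<forall>W. (AE x in lborel. W x = U x + l * a * V (a * x)) \<longrightarrow> schr_eigenvalue W (- (s * l / a)\<^sup>2))"
      by blast
  qed
qed

end

section \<open>The threshold eigenvalue in the limit of weak coupling\<close>

theorem theorem3:
  fixes U V :: "real \<Rightarrow> real" and alpha :: "real \<Rightarrow> real" and u :: "real \<Rightarrow> real" and \<theta> :: real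
  assumes U: "Linf_compact U" and V: "Linf_compact V"
    and alpha_pos: "\<forall>l::real. l > 0 \<longrightarrow> alpha l > 0"
    and alpha_inf: "filterlim alpha at_top (at_right 0)"
    and hbs: "half_bound_state U u" and u_left: "(u \<longlongrightarrow> 1) at_bot"
    and theta: "(u \<longlongrightarrow> \<theta>) at_top"
    and V0: "(LINT x|lborel. V x) = 0"
    and sign: "u 0 * deriv u 0 * (LINT x|lborel. x * V x) < 0"
    and alpha_small: "alpha \<in> o[at_right 0](\<lambda>l. l powr (-1/3))"
  shows "\<exists>e :: real \<Rightarrow> real.
     (\<forall>\<^sub>F l in at_right 0. e l < 0 \<and>
         schr_eigenvalue (\<lambda>x. U x + l * alpha l * V (alpha l * x)) (e l)) \<and>
     (e \<longlongrightarrow> 0) (at_right 0) \<and>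
     (\<exists>r :: real \<Rightarrow> real. (r \<longlongrightarrow> 0) (at_right 0) \<and>
        (\<forall>\<^sub>F l in at_right 0. e l = - (l\<^sup>2 / (alpha l)\<^sup>2) *
           ((2 * u 0 * deriv u 0 / (\<theta>\<^sup>2 + 1) * (LINT x|lborel. x * V x))\<^sup>2 + r l)))"
proof -
  obtain Ub M1 R1 where Ub: "Ub \<in> borel_measurable borel" "\<And>x. \<bar>Ub x\<bar> \<le> M1" "\<And>x. R1 < \<bar>x\<bar> \<Longrightarrow> Ub x = 0"
    "AE x in lborel. U x = Ub x" using Linf_compact_representative[OF U] by blast
  obtain Vb M2 R2 where Vb: "Vb \<in> borel_measurable borel" "\<And>x. \<bar>Vb x\<bar> \<le> M2" "\<And>x. R2 < \<bar>x\<bar> \<Longrightarrow> Vb x = 0"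
    "AE x in lborel. V x = Vb x" using Linf_compact_representative[OF V] by blast
  have mV: "V \<in> borel_measurable borel" using V by (simp add: Linf_compact_def)
  define M where "M = max M1 M2"
  \<comment> \<open>Positive and strictly beyond both support radii, so that the potentials vanish
    already at \<open>\<bar>x\<bar> = R\<close>.\<close>
  define R where "R = max 0 (max R1 R2) + 1"
  have R: "0 < R" "R1 < R" "R2 < R" by (auto simp: R_def)
  have supp: "Ub x = 0" if "R \<le> \<bar>x\<bar>" for x using Ub(3) R that by simp
  obtain u' where u': "schr_sol Ub UNIV u u'" "\<And>x. (u has_real_derivative u' x) (at x)"
    "u (-R) = 1" "u' (-R) = 0" "u R = \<theta>" "u' R = 0"
    using half_bound_state_normal_form[OF hbs Ub(4) supp less_imp_le[OF R(1)] u_left theta] by blast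
  have du: "deriv u 0 = u' 0" by (rule DERIV_imp_deriv[OF u'(2)])
  have mean: "(LINT x|lborel. Vb x) = (LINT x|lborel. V x)"
    by (rule integral_cong_AE) (use mV Vb in auto)
  have moment: "(LINT x|lborel. x * Vb x) = (LINT x|lborel. x * V x)"
    by (rule integral_cong_AE) (use mV Vb(1,4) in auto)
  interpret half_bound_dipole Ub Vb u u' R M \<theta>
  proof
    show "schr_sol Ub {-R..R} u u'" using schr_sol_subset[OF u'(1)] by simp
    show "\<bar>Ub x\<bar> \<le> M" "\<bar>Vb x\<bar> \<le> M" for x using Ub(2)[of x] Vb(2)[of x] by (auto simp: M_def)
    show "R \<le> \<bar>x\<bar> \<Longrightarrow> Ub x = 0" "R \<le> \<bar>x\<bar> \<Longrightarrow> Vb x = 0" for x using Ub(3) Vb(3) R by auto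
  qed (use Ub(1) Vb(1) R u' mean V0 in auto)
  have m_eq: "m = (LINT x|lborel. x * V x)" by (simp add: m_def moment)
  define c where "c = - (2 * u 0 * u' 0 / (\<theta>\<^sup>2 + 1) * m)"
  have neg: "u 0 * u' 0 * m < 0" using sign by (simp add: m_eq du)
  have c: "c > 0"
  proof -
    have "\<theta>\<^sup>2 + 1 > 0" by (simp add: add_nonneg_pos)
    then have "u 0 * u' 0 * m / (\<theta>\<^sup>2 + 1) < 0" using neg by (rule divide_neg_pos[rotated])
    then show ?thesis by (simp add: c_def)
  qed
  from eigenvalue_near_prediction[OF neg, folded c_def] obtain C where
    C: "\<And>l a. 0 < l \<Longrightarrow> 1 \<le> a \<Longrightarrow> l * a \<le> 1 \<Longrightarrow> C * (l * a + 1 / a) < c \<Longrightarrow>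
     \<exists>s>0. \<bar>s - c\<bar> \<le> C * (l * a + 1 / a) \<and> (\<forall>W. (AE x in lborel. W x = Ub x + l * a * Vb (a * x)) \<longrightarrow> schr_eigenvalue W (- (s * l / a)\<^sup>2))"
    by blast
  define \<eta> where "\<eta> l = C * (l * alpha l + 1 / alpha l)" for l
  define W where "W l x = U x + l * alpha l * V (alpha l * x)" for l x
  have pos: "\<forall>\<^sub>F l in at_right (0::real). 0 < l" by (simp add: eventually_at_right_less)
  \<comment> \<open>The only use of \<open>alpha_small\<close>: the perturbation tends to 0 uniformly, so the Jost solutions tend to \<open>u\<close> in \<open>C\<^sup>1\<close>.\<close>
  have la: "((\<lambda>l. l * alpha l) \<longlongrightarrow> 0) (at_right 0)"
  proof (rule Lim_null_comparison)
    have "\<forall>\<^sub>F l in at_right 0. norm (alpha l) \<le> 1 * norm (l powr (-1/3))"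
      using landau_o.smallD[OF alpha_small, of 1] by simp
    with pos show "\<forall>\<^sub>F l in at_right 0. norm (l * alpha l) \<le> l powr (2/3)"
    proof eventually_elim
      case (elim l)
      have "norm (l * alpha l) \<le> l * l powr (-1/3)" using elim by (simp add: abs_mult mult_left_mono)
      also have "\<dots> = l powr 1 * l powr (-1/3)" using elim by simp
      also have "\<dots> = l powr (2/3)" unfolding powr_add[symmetric] by simp
      finally show ?case .
    qed
    show "((\<lambda>l. l powr (2/3)) \<longlongrightarrow> 0) (at_right (0::real))"
      by (rule tendsto_zero_powrI[where b = "2/3"]) (auto intro!: tendsto_intros eventually_mono[OF pos])
  qed
  have inv: "((\<lambda>l. 1 / alpha l) \<longlongrightarrow> 0) (at_right 0)"
    using tendsto_inverse_0_at_top[OF alpha_inf] by (simp add: inverse_eq_divide)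
  have \<eta>: "(\<eta> \<longlongrightarrow> 0) (at_right 0)"
    unfolding \<eta>_def using tendsto_mult[OF tendsto_const tendsto_add[OF la inv], of C] by simp
  \<comment> \<open>The scaling by \<open>alpha l > 0\<close> pulls null sets back to null sets, so
    \<open>V\<close> may be exchanged for its representative after rescaling.\<close>
  have AE_W: "AE x in lborel. W l x = Ub x + l * alpha l * Vb (alpha l * x)" if "alpha l > 0" for l
  proof -
    have "AE x in lborel. V (0 + alpha l * x) = Vb (0 + alpha l * x)"
      by (rule AE_borel_affine) (use that mV Vb(1,4) in auto)
    with Ub(4) show ?thesis by eventually_elim (simp add: W_def)
  qed
  \<comment> \<open>A choice for each \<open>l\<close>; it is meaningful only for the small
    \<open>l\<close> at which such a number exists.\<close>
  define s where "s l = (SOME s. 0 < s \<and> \<bar>s - c\<bar> \<le> \<eta> l \<and> schr_eigenvalue (W l) (- (s * l / alpha l)\<^sup>2))" for l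
  have s: "\<forall>\<^sub>F l in at_right 0. 0 < l \<and> 0 < s l \<and> \<bar>s l - c\<bar> \<le> \<eta> l \<and> schr_eigenvalue (W l) (- (s l * l / alpha l)\<^sup>2)"
  proof -
    have "\<forall>\<^sub>F l in at_right 0. 1 \<le> alpha l" using alpha_inf by (simp add: filterlim_at_top)
    moreover have "\<forall>\<^sub>F l in at_right 0. l * alpha l < 1" using order_tendstoD(2)[OF la] by simp
    moreover have "\<forall>\<^sub>F l in at_right 0. \<eta> l < c" using order_tendstoD(2)[OF \<eta>] c by simp
    ultimately show ?thesis using pos
    proof eventually_elim
      case (elim l)
      then have "\<exists>s. 0 < s \<and> \<bar>s - c\<bar> \<le> \<eta> l \<and> schr_eigenvalue (W l) (- (s * l / alpha l)\<^sup>2)"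
        using C[of l "alpha l"] AE_W[of l] by (auto simp: \<eta>_def)
      from someI_ex[OF this, folded s_def] elim(4) show ?case by simp
    qed
  qed
  have "((\<lambda>l. s l - c) \<longlongrightarrow> 0) (at_right 0)"
    by (rule Lim_null_comparison[OF _ \<eta>]) (use s in \<open>auto elim: eventually_mono\<close>)
  then have s_lim: "(s \<longlongrightarrow> c) (at_right 0)" by (simp add: LIM_zero_iff)
  define e where "e l = - (s l * l / alpha l)\<^sup>2" for l
  show ?thesis
  proof (rule exI[of _ e], intro conjI, goal_cases)
    case 1
    show ?case
      using s
    proof eventually_elim
      case (elim l)
      then have "s l * l / alpha l \<noteq> 0" using alpha_pos by (metis divide_eq_0_iff less_irrefl mult_eq_0_iff)
      with elim show ?case by (simp add: e_def W_def[abs_def])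
    qed
  next
    case 2
    have "((\<lambda>l. - (s l * l * (1 / alpha l))\<^sup>2) \<longlongrightarrow> - (c * 0 * 0)\<^sup>2) (at_right 0)"
      by (intro tendsto_intros s_lim inv)
    then show ?case by (simp add: e_def[abs_def])
  next
    case 3
    \<comment> \<open>The eigenvalue is exactly \<open>- (s l)^2 * (l / alpha l)^2\<close>, so the
      \<open>o(1)\<close> term is the difference between \<open>(s l)^2\<close> and its
      limit.\<close>
    show ?case
    proof (rule exI[of _ "\<lambda>l. (s l)\<^sup>2 - c\<^sup>2"], rule conjI)
      have "((\<lambda>l. (s l)\<^sup>2 - c\<^sup>2) \<longlongrightarrow> c\<^sup>2 - c\<^sup>2) (at_right 0)"
        by (intro tendsto_intros s_lim)
      then show "((\<lambda>l. (s l)\<^sup>2 - c\<^sup>2) \<longlongrightarrow> 0) (at_right 0)" by simp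
      have "(2 * u 0 * deriv u 0 / (\<theta>\<^sup>2 + 1) * (LINT x|lborel. x * V x))\<^sup>2 = c\<^sup>2"
        by (simp add: c_def du m_eq)
      then show "\<forall>\<^sub>F l in at_right 0. e l = - (l\<^sup>2 / (alpha l)\<^sup>2) *
             ((2 * u 0 * deriv u 0 / (\<theta>\<^sup>2 + 1) * (LINT x|lborel. x * V x))\<^sup>2 + ((s l)\<^sup>2 - c\<^sup>2))"
        by (intro always_eventually) (simp add: e_def power_divide power_mult_distrib mult.commute)
    qed
  qed
qed

end
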